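(* There are absolute constants $C_1,C_2,C_3,c>0$ such that for every integer $k\ge 2$ there exists a graph $G$ with $2^{c k^4\log^3 k}\le |V(G)|\le 2^{C_1 k^4\log^3 k}$ vertices such that $\mathrm{bp}(G)\le 2^{C_2 k\log^4 k}$ and $\chi(G)\ge 2^{C_3 k^2}$.
   Context: For a graph $G$, $\chi(G)$ is its chromatic number and $\mathrm{bp}(G)$, the biclique partition number, is the smallest number of complete bipartite subgraphs (bicliques) whose edge sets partition $E(G)$. *)

theory Defs
  imports Complex_Main
begin

definition simple_graph :: "nat \<Rightarrow> nat set set \<Rightarrow> bool" where
  "simple_graph n E \<longleftrightarrow> (\<forall>e\<in>E. \<exists>u v. e = {u, v} \<and> u \<noteq> v \<and> u < n \<and> v < n)"

definition proper_colouring :: "nat \<Rightarrow> nat set set \<Rightarrow> nat \<Rightarrow> (nat \<Rightarrow> nat) \<Rightarrow> bool" where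
  "proper_colouring n E m f \<longleftrightarrow>
     (\<forall>v<n. f v < m) \<and> (\<forall>u<n. \<forall>v<n. {u, v} \<in> E \<longrightarrow> f u \<noteq> f v)"

definition chromatic_number :: "nat \<Rightarrow> nat set set \<Rightarrow> nat" where
  "chromatic_number n E = (LEAST m. \<exists>f. proper_colouring n E m f)"

definition biclique_edges :: "nat set \<Rightarrow> nat set \<Rightarrow> nat set set" where
  "biclique_edges A B = {{a, b} | a b. a \<in> A \<and> b \<in> B}"

definition is_biclique :: "nat \<Rightarrow> nat set set \<Rightarrow> nat set \<Rightarrow> nat set \<Rightarrow> bool" where
  "is_biclique n E A B \<longleftrightarrow> A \<noteq> {} \<and> B \<noteq> {} \<and> A \<inter> B = {} \<and>
     A \<subseteq> {0..<n} \<and> B \<subseteq> {0..<n} \<and> biclique_edges A B \<subseteq> E"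

definition biclique_partition ::
  "nat \<Rightarrow> nat set set \<Rightarrow> nat \<Rightarrow> (nat \<Rightarrow> nat set) \<Rightarrow> (nat \<Rightarrow> nat set) \<Rightarrow> bool" where
  "biclique_partition n E m A B \<longleftrightarrow>
     (\<forall>i<m. is_biclique n E (A i) (B i)) \<and>
     (\<forall>i<m. \<forall>j<m. i \<noteq> j \<longrightarrow> biclique_edges (A i) (B i) \<inter> biclique_edges (A j) (B j) = {}) \<and>
     (\<Union>i<m. biclique_edges (A i) (B i)) = E"

definition bp :: "nat \<Rightarrow> nat set set \<Rightarrow> nat" where
  "bp n E = (LEAST m. \<exists>A B. biclique_partition n E m A B)"

end

theory Submission
  imports Defs "HOL-Library.FuncSet"
begin

text \<open>
  The vertices are pairs \<open>(u, c)\<close>, where \<open>u\<close> assigns letters to a set of coordinates and \<open>c\<close> assigns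
  contents to \<open>2 ^ m\<close> cells, and adjacency of \<open>s\<close> and \<open>s'\<close> is an unambiguous DNF in the pattern of the coordinates at
  which they differ. Its terms come from a partial function with two kinds of certificates of width \<open>k\<close> up to
  logarithms: certificates of different kinds contradict each other, but to refute one kind on the all-equal
  pattern one must inspect about \<open>k\<^sup>2\<close> coordinates. Unambiguity is enforced by a cheat sheet: \<open>m\<close> copies of the
  function spell the address of a cell, and this cell has to name the certificates that are used. Few short terms give few
  bicliques. Conversely, an independent set cannot have density \<open>2 ^ - k\<^sup>2\<close>: as there are more than \<open>k\<^sup>2 + 1\<close>
  cells, some cell is nearly unrestricted on a dense part of the set, and a density increment argument produces there
  two vertices whose difference pattern contains the certificates addressed by this cell.
\<close>

section \<open>From bicliques to chromatic number\<close>

text \<open>Lets partitions be indexed by structured data, whereas \<open>bp\<close> numbers the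
  bicliques by an initial segment of the naturals.\<close>

lemma bp_le:
  assumes "finite K"
    and bic: "\<And>\<kappa>. \<kappa> \<in> K \<Longrightarrow> is_biclique n E (X \<kappa>) (Y \<kappa>)"
    and disj: "\<And>\<kappa> \<kappa>'. \<kappa> \<in> K \<Longrightarrow> \<kappa>' \<in> K \<Longrightarrow> \<kappa> \<noteq> \<kappa>' \<Longrightarrow>
      biclique_edges (X \<kappa>) (Y \<kappa>) \<inter> biclique_edges (X \<kappa>') (Y \<kappa>') = {}"
    and cover: "(\<Union>\<kappa>\<in>K. biclique_edges (X \<kappa>) (Y \<kappa>)) = E"
  shows "bp n E \<le> card K"
proof -
  obtain h where h: "bij_betw h {..<card K} K"
    using ex_bij_betw_nat_finite[OF \<open>finite K\<close>] by (auto simp: atLeast0LessThan)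
  have hK: "h i \<in> K" if "i < card K" for i
    using h that by (auto simp: bij_betw_def)
  have hinj: "h i \<noteq> h j" if "i < card K" "j < card K" "i \<noteq> j" for i j
    using h that by (auto simp: bij_betw_def inj_on_def)
  have "(\<Union>i<card K. biclique_edges (X (h i)) (Y (h i))) = (\<Union>\<kappa>\<in>h ` {..<card K}. biclique_edges (X \<kappa>) (Y \<kappa>))"
    by simp
  also have "\<dots> = E"
    using cover h by (simp add: bij_betw_def)
  finally have "biclique_partition n E (card K) (X \<circ> h) (Y \<circ> h)"
    using bic hK disj hinj by (simp add: biclique_partition_def)
  then show ?thesis
    unfolding bp_def by (intro Least_le) blast
qed

lemma le_chromatic_number:
  assumes "simple_graph n E"
    and "\<And>m f. proper_colouring n E m f \<Longrightarrow> L \<le> m"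
  shows "L \<le> chromatic_number n E"
proof -
  \<comment> \<open>Without some proper colouring the \<open>LEAST\<close> in the chromatic number
    would be unspecified; giving every vertex its own colour provides one.\<close>
  have "proper_colouring n E n id"
    using assms(1) unfolding proper_colouring_def simple_graph_def
    by (auto simp: doubleton_eq_iff)
  then have "\<exists>m f. proper_colouring n E m f" by blast
  then have "\<exists>f. proper_colouring n E (chromatic_number n E) f"
    unfolding chromatic_number_def by (rule LeastI_ex)
  then show ?thesis using assms(2) by blast
qed

text \<open>An injection carries \<open>V\<close> into the first \<open>n\<close> naturals, and the
  other vertices stay isolated, so \<open>n\<close> may be any number at least
  \<open>card V\<close>. Edges are unordered, hence \<open>uniq\<close> must exclude both
  orientations. By \<open>dense\<close>, an independent subset of \<open>V\<close> has density below
  \<open>1 / L\<close>, which bounds the number of colours from below.\<close>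

lemma biclique_family_graph:
  fixes V :: "'v set" and X Y :: "'k \<Rightarrow> 'v set"
  assumes fin: "finite V" "V \<noteq> {}" "card V \<le> n" "finite K"
    and sub: "\<And>\<kappa>. \<kappa> \<in> K \<Longrightarrow> X \<kappa> \<subseteq> V" "\<And>\<kappa>. \<kappa> \<in> K \<Longrightarrow> Y \<kappa> \<subseteq> V"
    and disj: "\<And>\<kappa>. \<kappa> \<in> K \<Longrightarrow> X \<kappa> \<inter> Y \<kappa> = {}"
    and uniq: "\<And>\<kappa> \<kappa>' x y. \<kappa> \<in> K \<Longrightarrow> \<kappa>' \<in> K \<Longrightarrow> x \<in> X \<kappa> \<Longrightarrow> y \<in> Y \<kappa> \<Longrightarrow>
      (x \<in> X \<kappa>' \<and> y \<in> Y \<kappa>') \<or> (y \<in> X \<kappa>' \<and> x \<in> Y \<kappa>') \<Longrightarrow> \<kappa> = \<kappa>'"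
    and dense: "\<And>S. S \<subseteq> V \<Longrightarrow> card V \<le> card S * L \<Longrightarrow>
      \<exists>\<kappa>\<in>K. \<exists>x\<in>S. \<exists>y\<in>S. x \<in> X \<kappa> \<and> y \<in> Y \<kappa>"
  shows "\<exists>E. simple_graph n E \<and> bp n E \<le> card K \<and> L \<le> chromatic_number n E"
proof -
  obtain \<phi> where \<phi>: "bij_betw \<phi> V {..<card V}"
    using ex_bij_betw_finite_nat[OF \<open>finite V\<close>] by (auto simp: atLeast0LessThan)
  have \<phi>lt: "\<phi> v < n" if "v \<in> V" for v
    using bij_betwE[OF \<phi>] that fin(3) by (meson lessThan_iff less_le_trans)
  have \<phi>inj: "\<phi> v = \<phi> v' \<longleftrightarrow> v = v'" if "v \<in> V" "v' \<in> V" for v v'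
    using \<phi> that by (auto simp: bij_betw_def inj_on_def)
  define P where "P = (\<lambda>\<kappa>. \<phi> ` X \<kappa>)"
  define R where "R = (\<lambda>\<kappa>. \<phi> ` Y \<kappa>)"
  define E where "E = (\<Union>\<kappa>\<in>K. biclique_edges (P \<kappa>) (R \<kappa>))"
  have edge: "{\<phi> x, \<phi> y} \<in> biclique_edges (P \<kappa>) (R \<kappa>) \<longleftrightarrow>
      (x \<in> X \<kappa> \<and> y \<in> Y \<kappa>) \<or> (y \<in> X \<kappa> \<and> x \<in> Y \<kappa>)"
    if V: "x \<in> V" "y \<in> V" "\<kappa> \<in> K" for x y \<kappa>
  proof -
    have mem: "\<phi> v \<in> P \<kappa> \<longleftrightarrow> v \<in> X \<kappa>" "\<phi> v \<in> R \<kappa> \<longleftrightarrow> v \<in> Y \<kappa>" if "v \<in> V" for v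
      using that sub[OF V(3)] \<phi>inj unfolding P_def R_def by blast+
    have "{\<phi> x, \<phi> y} \<in> biclique_edges (P \<kappa>) (R \<kappa>) \<longleftrightarrow>
        (\<phi> x \<in> P \<kappa> \<and> \<phi> y \<in> R \<kappa>) \<or> (\<phi> y \<in> P \<kappa> \<and> \<phi> x \<in> R \<kappa>)"
      unfolding biclique_edges_def by (auto simp: doubleton_eq_iff)
    then show ?thesis using mem V by simp
  qed
  have edgeD: "\<exists>x y. e = {\<phi> x, \<phi> y} \<and> x \<in> X \<kappa> \<and> y \<in> Y \<kappa>"
    if "e \<in> biclique_edges (P \<kappa>) (R \<kappa>)" for e \<kappa>
    using that by (auto simp: biclique_edges_def P_def R_def)
  have sg: "simple_graph n E"
    unfolding simple_graph_def
  proof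
    fix e assume "e \<in> E"
    then obtain \<kappa> x y where *: "\<kappa> \<in> K" "e = {\<phi> x, \<phi> y}" "x \<in> X \<kappa>" "y \<in> Y \<kappa>"
      unfolding E_def using edgeD by blast
    then have "x \<in> V" "y \<in> V" "x \<noteq> y" using sub disj by blast+
    then show "\<exists>u v. e = {u, v} \<and> u \<noteq> v \<and> u < n \<and> v < n"
      using * \<phi>lt \<phi>inj by blast
  qed
  \<comment> \<open>Bicliques must have nonempty sides, so indices with an empty side are dropped;
    they contribute no edges.\<close>
  define K' where "K' = {\<kappa> \<in> K. X \<kappa> \<noteq> {} \<and> Y \<kappa> \<noteq> {}}"
  have "finite K'" using fin by (simp add: K'_def)
  have "bp n E \<le> card K'"
  proof (rule bp_le[of K' n E P R])
    fix \<kappa> assume "\<kappa> \<in> K'"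
    then have \<kappa>: "\<kappa> \<in> K" "X \<kappa> \<noteq> {}" "Y \<kappa> \<noteq> {}" by (auto simp: K'_def)
    have "P \<kappa> \<inter> R \<kappa> = {}"
      using disj[OF \<kappa>(1)] sub[OF \<kappa>(1)] \<phi>inj unfolding P_def R_def by blast
    moreover have "P \<kappa> \<subseteq> {0..<n}" "R \<kappa> \<subseteq> {0..<n}"
      using sub[OF \<kappa>(1)] \<phi>lt unfolding P_def R_def by auto
    ultimately show "is_biclique n E (P \<kappa>) (R \<kappa>)"
      using \<kappa> unfolding is_biclique_def E_def by (auto simp: P_def R_def)
  next
    fix \<kappa> \<kappa>' assume "\<kappa> \<in> K'" "\<kappa>' \<in> K'" and ne: "\<kappa> \<noteq> \<kappa>'"
    then have \<kappa>: "\<kappa> \<in> K" "\<kappa>' \<in> K" by (auto simp: K'_def)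
    show "biclique_edges (P \<kappa>) (R \<kappa>) \<inter> biclique_edges (P \<kappa>') (R \<kappa>') = {}"
    proof (rule ccontr)
      assume "\<not> ?thesis"
      then obtain x y where "x \<in> X \<kappa>" "y \<in> Y \<kappa>"
        and "{\<phi> x, \<phi> y} \<in> biclique_edges (P \<kappa>') (R \<kappa>')"
        using edgeD by blast
      moreover from this have "x \<in> V" "y \<in> V" using sub \<kappa> by blast+
      ultimately show False using uniq[OF \<kappa>] edge[of x y \<kappa>'] \<kappa> ne by blast
    qed
  next
    have "biclique_edges (P \<kappa>) (R \<kappa>) = {}" if "\<kappa> \<in> K - K'" for \<kappa>
      using that by (auto simp: K'_def biclique_edges_def P_def R_def)
    then show "(\<Union>\<kappa>\<in>K'. biclique_edges (P \<kappa>) (R \<kappa>)) = E"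
      unfolding E_def K'_def by blast
  qed fact
  also have "card K' \<le> card K"
    using fin by (auto simp: K'_def intro: card_mono)
  finally have bp: "bp n E \<le> card K" .
  have "L \<le> chromatic_number n E"
  proof (rule le_chromatic_number[OF sg])
    fix m f assume f: "proper_colouring n E m f"
    define S where "S = (\<lambda>c. {v \<in> V. f (\<phi> v) = c})"
    \<comment> \<open>A colour class is independent, so \<open>dense\<close> keeps it small; summing
      over the \<open>m\<close> classes then compares \<open>L\<close> with
      \<open>m\<close>.\<close>
    have small: "card (S c) * L \<le> card V" for c
    proof (rule ccontr)
      assume "\<not> ?thesis"
      then have "card V \<le> card (S c) * L" by simp
      moreover have "S c \<subseteq> V" by (auto simp: S_def)
      ultimately obtain \<kappa> x y where *: "\<kappa> \<in> K" "x \<in> S c" "y \<in> S c" "x \<in> X \<kappa>" "y \<in> Y \<kappa>"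
        using dense by blast
      then have "x \<in> V" "y \<in> V" by (auto simp: S_def)
      then have "{\<phi> x, \<phi> y} \<in> E" using * edge unfolding E_def by blast
      then have "f (\<phi> x) \<noteq> f (\<phi> y)"
        using f \<phi>lt \<open>x \<in> V\<close> \<open>y \<in> V\<close> unfolding proper_colouring_def by blast
      then show False using * by (auto simp: S_def)
    qed
    have "V \<subseteq> (\<Union>c<m. S c)"
      using f \<phi>lt by (auto simp: S_def proper_colouring_def)
    then have "card V \<le> card (\<Union>c<m. S c)"
      using fin by (intro card_mono) (auto simp: S_def)
    also have "\<dots> \<le> (\<Sum>c<m. card (S c))"
      by (rule card_UN_le) simp
    finally have "card V * L \<le> (\<Sum>c<m. card (S c) * L)"
      by (simp add: sum_distrib_right[symmetric])
    also have "\<dots> \<le> (\<Sum>c<m. card V)"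
      by (intro sum_mono small)
    finally have "card V * L \<le> card V * m" by (simp add: mult.commute)
    then show "L \<le> m" using fin(1,2) by (simp add: card_gt_0_iff)
  qed
  with sg bp show ?thesis by blast
qed

section \<open>Dense sets of words\<close>

text \<open>Every such subset is the set of proper letters of a word of length \<open>w\<close> over
  \<open>I\<close> and the blank \<open>None\<close>, which serves as padding.\<close>

lemma card_small_subsets_le:
  assumes "finite I"
  shows "finite {A. A \<subseteq> I \<and> card A \<le> w}" "card {A. A \<subseteq> I \<and> card A \<le> w} \<le> Suc (card I) ^ w"
proof -
  show "finite {A. A \<subseteq> I \<and> card A \<le> w}" using assms by simp
  define L where "L = {xs. set xs \<subseteq> insert None (Some ` I) \<and> length xs = w}"
  define h where "h = (\<lambda>xs. {x. Some x \<in> set xs} :: 'a set)"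
  have finL: "finite L" unfolding L_def using assms by (intro finite_lists_length_eq) auto
  have "card L = card (insert None (Some ` I)) ^ w"
    unfolding L_def using assms by (intro card_lists_length_eq) auto
  also have "card (insert None (Some ` I)) = Suc (card I)"
    using assms by (subst card_insert_disjoint) (auto simp: card_image)
  finally have cL: "card L = Suc (card I) ^ w" .
  have "{A. A \<subseteq> I \<and> card A \<le> w} \<subseteq> h ` L"
  proof
    fix A assume "A \<in> {A. A \<subseteq> I \<and> card A \<le> w}"
    then have A: "A \<subseteq> I" "card A \<le> w" by auto
    then have "finite A" using assms finite_subset by blast
    then obtain xs where xs: "set xs = A" "distinct xs" using finite_distinct_list by blast
    define ys where "ys = map Some xs @ replicate (w - length xs) None"
    have "length xs = card A" using xs distinct_card by fastforce
    then have "ys \<in> L" "h ys = A"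
      using xs A by (auto simp: ys_def L_def h_def)
    then show "A \<in> h ` L" by blast
  qed
  then have "card {A. A \<subseteq> I \<and> card A \<le> w} \<le> card (h ` L)"
    using finL by (intro card_mono) auto
  also have "\<dots> \<le> card L" using finL by (rule card_image_le)
  finally show "card {A. A \<subseteq> I \<and> card A \<le> w} \<le> Suc (card I) ^ w" using cL by simp
qed

lemma card_agree_on_le:
  assumes "finite I" "U \<subseteq> I \<rightarrow>\<^sub>E {..<Q::nat}" "\<And>u u' x. u \<in> U \<Longrightarrow> u' \<in> U \<Longrightarrow> x \<in> J \<Longrightarrow> u x = u' x"
  shows "card U \<le> Q ^ card (I - J)"
proof -
  have "inj_on (\<lambda>u. restrict u (I - J)) U"
  proof (rule inj_onI)
    fix u u' assume *: "u \<in> U" "u' \<in> U" "restrict u (I - J) = restrict u' (I - J)"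
    show "u = u'"
    proof
      fix x
      consider "x \<in> J" | "x \<in> I - J" | "x \<notin> I" by blast
      then show "u x = u' x"
      proof cases
        case 1
        then show ?thesis using assms(3) * by blast
      next
        case 2
        then show ?thesis using fun_cong[OF *(3), of x] by simp
      next
        case 3
        then show ?thesis using * PiE_arb[OF subsetD[OF assms(2)]] by metis
      qed
    qed
  qed
  moreover have "(\<lambda>u. restrict u (I - J)) ` U \<subseteq> (I - J) \<rightarrow>\<^sub>E {..<Q}"
  proof (rule image_subsetI)
    fix u assume "u \<in> U"
    then show "restrict u (I - J) \<in> (I - J) \<rightarrow>\<^sub>E {..<Q}"
      using PiE_mem[OF subsetD[OF assms(2)]] by (simp add: restrict_PiE_iff)
  qed
  moreover have "finite ((I - J) \<rightarrow>\<^sub>E {..<Q})" using assms(1) by (intro finite_PiE) auto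
  ultimately have "card U \<le> card ((I - J) \<rightarrow>\<^sub>E {..<Q})"
    by (rule card_inj_on_le)
  also have "\<dots> = Q ^ card (I - J)" using assms(1) by (simp add: card_PiE)
  finally show ?thesis .
qed

text \<open>Density increment: as long as some coordinate takes some value with probability above \<open>2 / Q\<close>, fixing it
  doubles the density, which can happen at most \<open>K\<close> times.\<close>

lemma spread_subset:
  assumes "finite I" "J \<subseteq> I" "U \<subseteq> I \<rightarrow>\<^sub>E {..<Q::nat}" "0 < Q"
    and "\<And>u u' x. u \<in> U \<Longrightarrow> u' \<in> U \<Longrightarrow> x \<in> J \<Longrightarrow> u x = u' x"
    and "Q ^ card (I - J) \<le> card U * 2 ^ K"
  shows "\<exists>T U'. T \<subseteq> I - J \<and> card T \<le> K \<and> U' \<subseteq> U \<and> U' \<noteq> {} \<and>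
    (\<forall>u\<in>U'. \<forall>u'\<in>U'. \<forall>x\<in>J \<union> T. u x = u' x) \<and>
    (\<forall>x\<in>I - (J \<union> T). \<forall>\<beta>. card {u \<in> U'. u x = \<beta>} * Q \<le> 2 * card U')"
  using assms(2-)
proof (induction K arbitrary: J U)
  case (0 J U)
  \<comment> \<open>With no deficiency left, \<open>U\<close> fills its whole subcube, so each value
    of a free coordinate takes at most a fraction \<open>1 / Q\<close> of it.\<close>
  have "card {u \<in> U. u x = \<beta>} * Q \<le> 2 * card U" if "x \<in> I - J" for x \<beta>
  proof -
    have "card {u \<in> U. u x = \<beta>} \<le> Q ^ card (I - insert x J)"
      using 0 assms(1) by (intro card_agree_on_le) auto
    then have "card {u \<in> U. u x = \<beta>} * Q \<le> Q * Q ^ card (I - insert x J)" by simp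
    also have "I - insert x J = (I - J) - {x}" by blast
    also have "Q * Q ^ card ((I - J) - {x}) = Q ^ card (I - J)"
      using that assms(1) by (metis card.remove finite_Diff power_Suc)
    also have "\<dots> \<le> card U" using 0 by simp
    finally show ?thesis by simp
  qed
  moreover have "U \<noteq> {}" using 0 by auto
  ultimately show ?case using 0 by (intro exI[of _ "{}"] exI[of _ U]) auto
next
  case (Suc K J U)
  show ?case
  proof (cases "\<exists>x\<in>I - J. \<exists>\<beta>. 2 * card U < card {u \<in> U. u x = \<beta>} * Q")
    case False
    have "U \<noteq> {}" using Suc.prems by auto
    then show ?thesis using False Suc.prems
      by (intro exI[of _ "{}"] exI[of _ U]) (auto simp: not_less)
  next
    case True
    then obtain x \<beta> where x: "x \<in> I - J" "2 * card U < card {u \<in> U. u x = \<beta>} * Q" by blast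
    \<comment> \<open>Fixing \<open>x\<close> keeps more than \<open>2 / Q\<close> of
      \<open>U\<close> in a subcube smaller by the factor \<open>Q\<close>; the density at least
      doubles and the deficiency drops from \<open>Suc K\<close> to \<open>K\<close>.\<close>
    define U1 where "U1 = {u \<in> U. u x = \<beta>}"
    have "Q * Q ^ card ((I - J) - {x}) = Q ^ card (I - J)"
      using x assms(1) by (metis card.remove finite_Diff power_Suc)
    also have "\<dots> \<le> 2 * card U * 2 ^ K" using Suc.prems by (simp add: mult_ac)
    also have "\<dots> \<le> card U1 * Q * 2 ^ K"
      using x(2) unfolding U1_def by (intro mult_right_mono) auto
    finally have "Q * Q ^ card (I - insert x J) \<le> Q * (card U1 * 2 ^ K)"
      by (simp add: mult_ac Diff_insert2[symmetric] Diff_insert[symmetric])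
    then have "Q ^ card (I - insert x J) \<le> card U1 * 2 ^ K"
      using \<open>0 < Q\<close> by simp
    moreover have "insert x J \<subseteq> I" "U1 \<subseteq> I \<rightarrow>\<^sub>E {..<Q}"
      using x Suc.prems by (auto simp: U1_def)
    moreover have "u y = u' y" if "u \<in> U1" "u' \<in> U1" "y \<in> insert x J" for u u' y
      using that Suc.prems(4) by (auto simp: U1_def)
    ultimately obtain T U' where T: "T \<subseteq> I - insert x J" "card T \<le> K" "U' \<subseteq> U1" "U' \<noteq> {}"
      "\<forall>u\<in>U'. \<forall>u'\<in>U'. \<forall>y\<in>insert x J \<union> T. u y = u' y"
      "\<forall>y\<in>I - (insert x J \<union> T). \<forall>\<beta>. card {u \<in> U'. u y = \<beta>} * Q \<le> 2 * card U'"
      using Suc.IH[of "insert x J" U1] \<open>0 < Q\<close> by blast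
    have "finite T" using T(1) assms(1) finite_subset by blast
    then have "card (insert x T) \<le> Suc K" using T(2) by (simp add: card_insert_if)
    moreover have "J \<union> insert x T = insert x J \<union> T" by blast
    moreover have "insert x T \<subseteq> I - J" using T(1) x(1) by blast
    moreover have "U' \<subseteq> U" using T(3) by (auto simp: U1_def)
    ultimately show ?thesis
      using T(4-6) by (intro exI[of _ "insert x T"] exI[of _ U']) simp
  qed
qed

text \<open>Averaging: among the assignments to \<open>J\<close>, some fibre of \<open>U\<close> is
  at least as dense in its subcube as \<open>U\<close> is in the full cube.\<close>

lemma dense_restriction:
  assumes "finite I" "J \<subseteq> I" "U \<subseteq> I \<rightarrow>\<^sub>E {..<Q::nat}" "0 < Q" "Q ^ card I \<le> card U * 2 ^ K"
  shows "\<exists>U1 \<subseteq> U. (\<forall>u\<in>U1. \<forall>u'\<in>U1. \<forall>x\<in>J. u x = u' x) \<and> Q ^ card (I - J) \<le> card U1 * 2 ^ K"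
proof -
  define cls where "cls = (\<lambda>\<sigma>. {u \<in> U. restrict u J = \<sigma>})"
  have finJ: "finite J" using assms finite_subset by blast
  have finU: "finite U" using assms by (meson finite_PiE finite_lessThan finite_subset)
  have finP: "finite (J \<rightarrow>\<^sub>E {..<Q})" using finJ by (intro finite_PiE) auto
  have "\<exists>\<sigma>\<in>J \<rightarrow>\<^sub>E {..<Q}. Q ^ card (I - J) \<le> card (cls \<sigma>) * 2 ^ K"
  proof (rule ccontr)
    assume "\<not> ?thesis"
    then have lt: "card (cls \<sigma>) * 2 ^ K < Q ^ card (I - J)" if "\<sigma> \<in> J \<rightarrow>\<^sub>E {..<Q}" for \<sigma>
      using that by force
    have "U \<subseteq> (\<Union>\<sigma>\<in>J \<rightarrow>\<^sub>E {..<Q}. cls \<sigma>)"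
    proof
      fix u assume "u \<in> U"
      then have "u x < Q" if "x \<in> J" for x using that assms(2,3) PiE_mem[of u I _ x] by blast
      then have "restrict u J \<in> J \<rightarrow>\<^sub>E {..<Q}" by (simp add: restrict_PiE_iff)
      then show "u \<in> (\<Union>\<sigma>\<in>J \<rightarrow>\<^sub>E {..<Q}. cls \<sigma>)" using \<open>u \<in> U\<close> by (auto simp: cls_def)
    qed
    then have "card U \<le> card (\<Union>\<sigma>\<in>J \<rightarrow>\<^sub>E {..<Q}. cls \<sigma>)"
      using finP finU by (intro card_mono) (auto simp: cls_def)
    also have "\<dots> \<le> (\<Sum>\<sigma>\<in>J \<rightarrow>\<^sub>E {..<Q}. card (cls \<sigma>))" by (rule card_UN_le[OF finP])
    finally have "card U * 2 ^ K \<le> (\<Sum>\<sigma>\<in>J \<rightarrow>\<^sub>E {..<Q}. card (cls \<sigma>) * 2 ^ K)"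
      by (simp add: sum_distrib_right[symmetric])
    also have "\<dots> < (\<Sum>\<sigma>\<in>J \<rightarrow>\<^sub>E {..<Q}. Q ^ card (I - J))"
      using finP lt \<open>0 < Q\<close> by (intro sum_strict_mono) (auto simp: PiE_eq_empty_iff)
    also have "\<dots> = Q ^ card J * Q ^ card (I - J)" using finJ by (simp add: card_PiE)
    also have "\<dots> = Q ^ card I"
      using assms(1,2) finJ by (simp add: card_Diff_subset card_mono flip: power_add)
    finally show False using assms(5) by simp
  qed
  then obtain \<sigma> where \<sigma>: "Q ^ card (I - J) \<le> card (cls \<sigma>) * 2 ^ K" by blast
  have "u x = u' x" if "u \<in> cls \<sigma>" "u' \<in> cls \<sigma>" "x \<in> J" for u u' x
  proof -
    have "restrict u J x = restrict u' J x" using that by (simp add: cls_def)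
    then show ?thesis using that by simp
  qed
  then show ?thesis using \<sigma> by (intro exI[of _ "cls \<sigma>"]) (auto simp: cls_def)
qed

text \<open>After restricting to \<open>J\<close> and spreading, fix any \<open>u\<close> in the
  remaining set. Another word agrees with \<open>u\<close> at a given free coordinate with
  probability at most \<open>2 / Q\<close>, and the union bound over \<open>D\<close> stays below 1
  because \<open>2 * w < Q\<close>. The set \<open>T\<close> is chosen before \<open>D\<close>, so
  \<open>D\<close> may depend on it.\<close>

lemma dense_pair:
  assumes "finite I" "J \<subseteq> I" "U \<subseteq> I \<rightarrow>\<^sub>E {..<Q::nat}" "2 * w < Q" "Q ^ card I \<le> card U * 2 ^ K"
  shows "\<exists>T \<subseteq> I - J. card T \<le> K \<and> (\<forall>D \<subseteq> I - (J \<union> T). card D \<le> w \<longrightarrow>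
    (\<exists>u\<in>U. \<exists>u'\<in>U. (\<forall>x\<in>J. u x = u' x) \<and> (\<forall>x\<in>D. u x \<noteq> u' x)))"
proof -
  have "0 < Q" using assms(4) by simp
  obtain U1 where U1: "U1 \<subseteq> U" "\<forall>u\<in>U1. \<forall>u'\<in>U1. \<forall>x\<in>J. u x = u' x" "Q ^ card (I - J) \<le> card U1 * 2 ^ K"
    using dense_restriction[OF assms(1-3) \<open>0 < Q\<close> assms(5)] by blast
  have U1I: "U1 \<subseteq> I \<rightarrow>\<^sub>E {..<Q}" using U1(1) assms(3) by blast
  have agree: "u x = u' x" if "u \<in> U1" "u' \<in> U1" "x \<in> J" for u u' x
    using U1(2) that by blast
  obtain T U' where T: "T \<subseteq> I - J" "card T \<le> K" "U' \<subseteq> U1" "U' \<noteq> {}"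
      "\<forall>u\<in>U'. \<forall>u'\<in>U'. \<forall>x\<in>J \<union> T. u x = u' x"
      "\<forall>x\<in>I - (J \<union> T). \<forall>\<beta>. card {u \<in> U'. u x = \<beta>} * Q \<le> 2 * card U'"
    using spread_subset[where U = U1 and K = K, OF assms(1,2) U1I \<open>0 < Q\<close> _ U1(3)] agree
    by (elim meta_impE exE conjE) (assumption, rule that)
  obtain u where u: "u \<in> U'" using T(4) by blast
  have finU': "finite U'"
    using T(3) U1I assms(1) by (meson finite_PiE finite_lessThan finite_subset)
  have "\<exists>u'\<in>U'. \<forall>x\<in>D. u x \<noteq> u' x" if D: "D \<subseteq> I - (J \<union> T)" "card D \<le> w" for D
  proof (rule ccontr)
    assume no: "\<not> ?thesis"
    have cover: "U' \<subseteq> (\<Union>x\<in>D. {u' \<in> U'. u' x = u x})"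
    proof
      fix v assume v: "v \<in> U'"
      then obtain x where "x \<in> D" "u x = v x" using no by blast
      then show "v \<in> (\<Union>x\<in>D. {u' \<in> U'. u' x = u x})"
        using v by (intro UN_I[of x]) simp_all
    qed
    have finD: "finite D" using D(1) assms(1) finite_subset by blast
    have "card U' \<le> card (\<Union>x\<in>D. {u' \<in> U'. u' x = u x})"
      using finU' finD cover by (intro card_mono finite_UN_I) simp_all
    also have "\<dots> \<le> (\<Sum>x\<in>D. card {u' \<in> U'. u' x = u x})" by (rule card_UN_le[OF finD])
    finally have "card U' * Q \<le> (\<Sum>x\<in>D. card {u' \<in> U'. u' x = u x} * Q)"
      by (simp add: sum_distrib_right[symmetric])
    also have "\<dots> \<le> (\<Sum>x\<in>D. 2 * card U')"
      by (intro sum_mono) (use T(6) D(1) in blast)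
    also have "\<dots> \<le> (2 * w) * card U'" using D(2) by simp
    finally have "Q \<le> 2 * w" using T(4) finU' by (simp add: mult.commute card_gt_0_iff)
    then show False using assms(4) by simp
  qed
  then have "\<exists>u\<in>U. \<exists>u'\<in>U. (\<forall>x\<in>J. u x = u' x) \<and> (\<forall>x\<in>D. u x \<noteq> u' x)"
    if "D \<subseteq> I - (J \<union> T)" "card D \<le> w" for D
    using that agree u T(3) U1(1) by (meson subsetD)
  then show ?thesis using T(1,2) by (intro exI[of _ T]) simp
qed

text \<open>Pigeonhole modulo \<open>M\<close>: both \<open>A\<close> and the reflected set
  \<open>e - B\<close> occupy more than half of the residues.\<close>

lemma two_large_sets_sum:
  fixes A B :: "nat set"
  assumes "A \<subseteq> {..<M}" "B \<subseteq> {..<M}" "M < 2 * card A" "M < 2 * card B" "e < M"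
  shows "\<exists>a\<in>A. \<exists>b\<in>B. (a + b) mod M = e"
proof -
  define h where "h = (\<lambda>b. if b \<le> e then e - b else e + M - b)"
  have hsum: "(h b + b) mod M = e" if "b < M" for b
    using that assms(5) by (auto simp: h_def)
  have "inj_on h B"
    using assms(2,5) by (auto simp: inj_on_def h_def subset_iff split: if_splits)
  then have ch: "card (h ` B) = card B" by (rule card_image)
  have hB: "h ` B \<subseteq> {..<M}"
    using assms(2,5) by (auto simp: h_def subset_iff)
  have "A \<inter> h ` B \<noteq> {}"
  proof
    assume "A \<inter> h ` B = {}"
    then have "card A + card (h ` B) = card (A \<union> h ` B)"
      using assms(1) hB by (intro card_Un_disjoint[symmetric]) (auto intro: finite_subset)
    also have "\<dots> \<le> card {..<M}"
      using assms(1) hB by (intro card_mono) auto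
    finally show False using assms(3,4) ch by simp
  qed
  then show ?thesis using hsum assms(2) by blast
qed

section \<open>Term systems\<close>

text \<open>A term \<open>(E, D)\<close> asks two vertices to agree on \<open>E\<close> and to differ everywhere on \<open>D\<close>.
  Terms of different cells contradict each other, while terms of one cell are told apart by the content of the cell.
  By \<open>robust\<close>, every sufficiently dense set of vertices contains a pair that satisfies a term of the cell \<open>b\<close>:
  fix the coordinates in \<open>J b\<close> and then those in \<open>T\<close> whose distribution is concentrated.\<close>

locale term_system =
  fixes I :: "'i set" and B :: "'b set" and trm :: "'b \<Rightarrow> ('i set \<times> 'i set) set"
    and J :: "'b \<Rightarrow> 'i set" and w K :: nat
  assumes finite_I: "finite I" and finite_B: "finite B"
    and trm: "\<And>b E D. b \<in> B \<Longrightarrow> (E, D) \<in> trm b \<Longrightarrow>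
      E \<subseteq> I \<and> D \<subseteq> I \<and> card E \<le> w \<and> card D \<le> w \<and> D \<noteq> {}"
    and conflict: "\<And>b b' E D E' D'. b \<in> B \<Longrightarrow> b' \<in> B \<Longrightarrow> b \<noteq> b' \<Longrightarrow> (E, D) \<in> trm b \<Longrightarrow>
      (E', D') \<in> trm b' \<Longrightarrow> E \<inter> D' \<noteq> {} \<or> D \<inter> E' \<noteq> {}"
    and J_subset: "\<And>b. b \<in> B \<Longrightarrow> J b \<subseteq> I"
    and robust: "\<And>b T. b \<in> B \<Longrightarrow> T \<subseteq> I - J b \<Longrightarrow> card T \<le> K \<Longrightarrow>
      \<exists>(E, D) \<in> trm b. E \<subseteq> J b \<and> D \<inter> (J b \<union> T) = {}"
begin

text \<open>The smallest alphabet for which the union bound in \<open>dense_pair\<close>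
  works.\<close>

definition Q :: nat where "Q = Suc (2 * w)"

text \<open>An upper bound for the number of pairs of sets of size at most \<open>w\<close>, so that
  the content of a single cell can name any term.\<close>

definition M :: nat where "M = (Suc (card I) ^ w)\<^sup>2"

abbreviation small_pairs :: "('i set \<times> 'i set) set" where
  "small_pairs \<equiv> {A. A \<subseteq> I \<and> card A \<le> w} \<times> {A. A \<subseteq> I \<and> card A \<le> w}"

definition code :: "'i set \<times> 'i set \<Rightarrow> nat" where
  "code = (SOME h. inj_on h small_pairs \<and> h ` small_pairs \<subseteq> {..<M})"

lemma finite_small_pairs: "finite small_pairs"
  using card_small_subsets_le(1)[OF finite_I] by simp

lemma card_small_pairs: "card small_pairs \<le> M"
  unfolding M_def power2_eq_square card_cartesian_product
  using card_small_subsets_le(2)[OF finite_I] by (intro mult_mono) auto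

lemma code: "inj_on code small_pairs" "\<And>t. t \<in> small_pairs \<Longrightarrow> code t < M"
proof -
  obtain h where "bij_betw h small_pairs {0..<card small_pairs}"
    using ex_bij_betw_finite_nat[OF finite_small_pairs] by blast
  then have "inj_on h small_pairs \<and> h ` small_pairs \<subseteq> {..<M}"
    using card_small_pairs by (auto simp: bij_betw_def simp del: mem_Times_iff)
  then have "\<exists>h. inj_on h small_pairs \<and> h ` small_pairs \<subseteq> {..<M}" by blast
  then have "inj_on code small_pairs \<and> code ` small_pairs \<subseteq> {..<M}"
    unfolding code_def by (rule someI_ex)
  then show "inj_on code small_pairs" "\<And>t. t \<in> small_pairs \<Longrightarrow> code t < M" by blast+
qed

lemma trm_small: "b \<in> B \<Longrightarrow> t \<in> trm b \<Longrightarrow> t \<in> small_pairs"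
  using trm[of b "fst t" "snd t"] by (simp add: mem_Times_iff)

section \<open>Vertices, adjacency and bicliques of a term system\<close>

definition V :: "(('i \<Rightarrow> nat) \<times> ('b \<Rightarrow> nat)) set" where
  "V = (I \<rightarrow>\<^sub>E {..<Q}) \<times> (B \<rightarrow>\<^sub>E {..<M})"

lemma finite_V: "finite V"
  unfolding V_def using finite_I finite_B by (intro finite_cartesian_product finite_PiE) auto

lemma card_V: "card V = Q ^ card I * M ^ card B"
  unfolding V_def card_cartesian_product using finite_I finite_B by (simp add: card_PiE)

lemma Q_pos: "0 < Q" and M_pos: "0 < M"
  by (simp_all add: Q_def M_def)

text \<open>The two contents of a cell are added, not subtracted, to make the relation symmetric.\<close>

definition matches ::
  "'b \<Rightarrow> 'i set \<times> 'i set \<Rightarrow> ('i \<Rightarrow> nat) \<times> ('b \<Rightarrow> nat) \<Rightarrow> ('i \<Rightarrow> nat) \<times> ('b \<Rightarrow> nat) \<Rightarrow> bool" where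
  "matches b t s s' \<longleftrightarrow> (\<forall>x\<in>fst t. fst s x = fst s' x) \<and> (\<forall>x\<in>snd t. fst s x \<noteq> fst s' x) \<and>
     (snd s b + snd s' b) mod M = code t"

lemma matches_sym: "matches b t s s' \<longleftrightarrow> matches b t s' s"
  unfolding matches_def by (metis add.commute)

text \<open>Unambiguity has two sources: terms of different cells contradict each other by
  \<open>conflict\<close>, and within one cell the sum of the contents fixes the injective code of
  the term.\<close>

lemma matches_unique:
  assumes "b \<in> B" "t \<in> trm b" "b' \<in> B" "t' \<in> trm b'" "matches b t s s'" "matches b' t' s s'"
  shows "b = b' \<and> t = t'"
proof -
  have "b = b'"
  proof (rule ccontr)
    assume "b \<noteq> b'"
    then have "fst t \<inter> snd t' \<noteq> {} \<or> snd t \<inter> fst t' \<noteq> {}"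
      using conflict[of b b' "fst t" "snd t" "fst t'" "snd t'"] assms by simp
    then show False using assms(5,6) by (auto simp: matches_def)
  qed
  moreover have "t = t'"
  proof (rule inj_onD[OF code(1)])
    show "code t = code t'" using assms(5,6) calculation by (simp add: matches_def)
  qed (use trm_small assms in blast)+
  ultimately show ?thesis by simp
qed

text \<open>A biclique is determined by a term and the values of both endpoints on what the term reads.
  Every edge would be found in both orientations; the values at \<open>pivot t\<close> select one of them.\<close>

definition pivot :: "'i set \<times> 'i set \<Rightarrow> 'i" where
  "pivot t = (SOME x. x \<in> snd t)"

definition endpoints :: "'b \<Rightarrow> 'i set \<times> 'i set \<Rightarrow> ('i \<Rightarrow> nat) \<Rightarrow> nat \<Rightarrow> (('i \<Rightarrow> nat) \<times> ('b \<Rightarrow> nat)) set" where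
  "endpoints b t f c = {s \<in> V. restrict (fst s) (fst t \<union> snd t) = f \<and> snd s b = c}"

definition keys :: "(('b \<times> ('i set \<times> 'i set)) \<times> ('i \<Rightarrow> nat) \<times> ('i \<Rightarrow> nat) \<times> nat \<times> nat) set" where
  "keys = {((b, t), f, g, c, d). b \<in> B \<and> t \<in> trm b \<and>
     f \<in> (fst t \<union> snd t) \<rightarrow>\<^sub>E {..<Q} \<and> g \<in> (fst t \<union> snd t) \<rightarrow>\<^sub>E {..<Q} \<and> c < M \<and> d < M \<and>
     (\<forall>x\<in>fst t. f x = g x) \<and> (\<forall>x\<in>snd t. f x \<noteq> g x) \<and> (c + d) mod M = code t \<and>
     f (pivot t) < g (pivot t)}"

definition left where "left = (\<lambda>((b, t), f, g, c, d). endpoints b t f c)"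
definition right where "right = (\<lambda>((b, t), f, g, c, d). endpoints b t g d)"

lemma pivot_in: "b \<in> B \<Longrightarrow> t \<in> trm b \<Longrightarrow> pivot t \<in> snd t"
proof -
  assume "b \<in> B" "t \<in> trm b"
  then have "\<exists>x. x \<in> snd t" using trm[of b "fst t" "snd t"] by auto
  then show ?thesis unfolding pivot_def by (rule someI_ex)
qed

lemma keysD:
  assumes "((b, t), f, g, c, d) \<in> keys" "s \<in> left ((b, t), f, g, c, d)" "s' \<in> right ((b, t), f, g, c, d)"
  shows "b \<in> B" "t \<in> trm b" "matches b t s s'" "fst s (pivot t) < fst s' (pivot t)"
    "f = restrict (fst s) (fst t \<union> snd t)" "g = restrict (fst s') (fst t \<union> snd t)" "c = snd s b" "d = snd s' b"
proof -
  show b: "b \<in> B" "t \<in> trm b" using assms(1) by (auto simp: keys_def)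
  show eqs: "f = restrict (fst s) (fst t \<union> snd t)" "g = restrict (fst s') (fst t \<union> snd t)" "c = snd s b" "d = snd s' b"
    using assms(2,3) by (auto simp: left_def right_def endpoints_def)
  have "pivot t \<in> fst t \<union> snd t" using pivot_in b by simp
  then show "fst s (pivot t) < fst s' (pivot t)"
    using assms(1) eqs by (simp add: keys_def)
  have "f x = fst s x" "g x = fst s' x" if "x \<in> fst t \<union> snd t" for x
    using that eqs by simp_all
  moreover have "\<forall>x\<in>fst t. f x = g x" "\<forall>x\<in>snd t. f x \<noteq> g x" "(c + d) mod M = code t"
    using assms(1) by (auto simp: keys_def)
  ultimately show "matches b t s s'" unfolding matches_def using eqs(3,4) by (metis UnCI)
qed

text \<open>The cell and the term are determined by the pair of vertices, and the other components
  are read off from the endpoints. The reversed orientation is impossible because the left endpoint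
  has the smaller letter at the pivot.\<close>

lemma keys_unique:
  assumes "\<kappa> \<in> keys" "\<kappa>' \<in> keys" "s \<in> left \<kappa>" "s' \<in> right \<kappa>"
    and "(s \<in> left \<kappa>' \<and> s' \<in> right \<kappa>') \<or> (s' \<in> left \<kappa>' \<and> s \<in> right \<kappa>')"
  shows "\<kappa> = \<kappa>'"
proof -
  obtain b t f g c d where \<kappa>: "\<kappa> = ((b, t), f, g, c, d)" by (metis prod.exhaust)
  obtain b' t' f' g' c' d' where \<kappa>': "\<kappa>' = ((b', t'), f', g', c', d')" by (metis prod.exhaust)
  note 1 = keysD[OF assms(1)[unfolded \<kappa>] assms(3)[unfolded \<kappa>] assms(4)[unfolded \<kappa>]]
  from assms(5) show ?thesis
  proof (elim disjE conjE)
    assume "s \<in> left \<kappa>'" "s' \<in> right \<kappa>'"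
    note 2 = keysD[OF assms(2)[unfolded \<kappa>'] this[unfolded \<kappa>']]
    have "b = b' \<and> t = t'" using matches_unique 1(1-3) 2(1-3) by blast
    then show ?thesis using 1(5-) 2(5-) \<kappa> \<kappa>' by simp
  next
    assume "s' \<in> left \<kappa>'" "s \<in> right \<kappa>'"
    note 2 = keysD[OF assms(2)[unfolded \<kappa>'] this[unfolded \<kappa>']]
    have "matches b' t' s s'" using 2(3) matches_sym by blast
    then have "b = b' \<and> t = t'" using matches_unique 1(1-3) 2(1-2) by blast
    then show ?thesis using 1(4) 2(4) by simp
  qed
qed

lemma matches_key:
  assumes "b \<in> B" "t \<in> trm b" "matches b t s s'" "s \<in> V" "s' \<in> V"
  shows "\<exists>\<kappa>\<in>keys. (s \<in> left \<kappa> \<and> s' \<in> right \<kappa>) \<or> (s' \<in> left \<kappa> \<and> s \<in> right \<kappa>)"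
proof -
  have key: "\<exists>\<kappa>\<in>keys. s \<in> left \<kappa> \<and> s' \<in> right \<kappa>"
    if m: "matches b t s s'" "s \<in> V" "s' \<in> V" "fst s (pivot t) < fst s' (pivot t)" for s s'
  proof -
    let ?S = "fst t \<union> snd t"
    have S: "?S \<subseteq> I" using trm[OF assms(1), of "fst t" "snd t"] assms(2) by simp
    let ?\<kappa> = "((b, t), restrict (fst s) ?S, restrict (fst s') ?S, snd s b, snd s' b)"
    have p: "pivot t \<in> ?S" using pivot_in assms(1,2) by simp
    have VD: "restrict (fst s) ?S \<in> ?S \<rightarrow>\<^sub>E {..<Q}" "snd s b < M" if "s \<in> V" for s
    proof -
      have V: "fst s \<in> I \<rightarrow>\<^sub>E {..<Q}" "snd s \<in> B \<rightarrow>\<^sub>E {..<M}"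
        using that by (auto simp: V_def mem_Times_iff)
      show "restrict (fst s) ?S \<in> ?S \<rightarrow>\<^sub>E {..<Q}"
        using PiE_mem[OF V(1)] S by (auto simp: restrict_PiE_iff)
      show "snd s b < M" using PiE_mem[OF V(2) assms(1)] by simp
    qed
    have "?\<kappa> \<in> keys"
      using assms(1,2) m p VD[OF m(2)] VD[OF m(3)] unfolding keys_def by (auto simp: matches_def)
    moreover have "s \<in> left ?\<kappa>" "s' \<in> right ?\<kappa>"
      using m by (auto simp: left_def right_def endpoints_def)
    ultimately show ?thesis by blast
  qed
  have "fst s (pivot t) \<noteq> fst s' (pivot t)"
    using assms(3) pivot_in[OF assms(1,2)] by (auto simp: matches_def)
  then consider "fst s (pivot t) < fst s' (pivot t)" | "fst s' (pivot t) < fst s (pivot t)"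
    by linarith
  then show ?thesis
    using key[of s s'] key[of s' s] assms matches_sym by cases blast+
qed

text \<open>One factor \<open>M\<close> counts the terms of a cell and two count the contents at the
  endpoints. The two endpoint words live on at most \<open>2 * w\<close> coordinates each, which
  yields \<open>Q ^ (4 * w)\<close>.\<close>

lemma card_keys: "finite keys" "card keys \<le> card B * M ^ 3 * Q ^ (4 * w)"
proof -
  define R where "R = (\<lambda>(b :: 'b, t :: 'i set \<times> 'i set). ((fst t \<union> snd t) \<rightarrow>\<^sub>E {..<Q}) \<times>
    ((fst t \<union> snd t) \<rightarrow>\<^sub>E {..<Q}) \<times> {..<M} \<times> {..<M})"
  let ?A = "B \<times> small_pairs"
  have finA: "finite ?A" using finite_B finite_small_pairs by blast
  have sub: "keys \<subseteq> Sigma ?A R"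
  proof
    fix \<kappa> assume "\<kappa> \<in> keys"
    then obtain b t f g c d where \<kappa>: "\<kappa> = ((b, t), f, g, c, d)" "b \<in> B" "t \<in> trm b"
      "f \<in> (fst t \<union> snd t) \<rightarrow>\<^sub>E {..<Q}" "g \<in> (fst t \<union> snd t) \<rightarrow>\<^sub>E {..<Q}" "c < M" "d < M"
      unfolding keys_def by blast
    then have "(b, t) \<in> ?A" using trm_small by blast
    moreover have "(f, g, c, d) \<in> R (b, t)" using \<kappa> by (simp add: R_def)
    ultimately show "\<kappa> \<in> Sigma ?A R" unfolding \<kappa>(1) by (rule SigmaI)
  qed
  have fint: "finite (fst t \<union> snd t)" if "t \<in> small_pairs" for t
  proof -
    have "fst t \<subseteq> I" "snd t \<subseteq> I" using that by auto
    then show ?thesis using finite_I finite_subset by blast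
  qed
  have finR: "finite (R a)" if aA: "a \<in> ?A" for a
  proof -
    obtain b t where a: "a = (b, t)" "t \<in> small_pairs" using aA by blast
    have "finite ((fst t \<union> snd t) \<rightarrow>\<^sub>E {..<Q})"
      using fint[OF a(2)] by (rule finite_PiE) simp
    then show ?thesis unfolding R_def a by simp
  qed
  have finS: "finite (Sigma ?A R)" using finA finR by (rule finite_SigmaI)
  then show "finite keys" using sub by (rule finite_subset[rotated])
  have cR: "card (R a) \<le> Q ^ (4 * w) * M\<^sup>2" if aA: "a \<in> ?A" for a
  proof -
    obtain b t where a: "a = (b, t)" "t \<in> small_pairs" using aA by blast
    have c: "card (fst t \<union> snd t) \<le> 2 * w"
      using a(2) card_Un_le[of "fst t" "snd t"] by auto
    have "card (R a) = (Q ^ card (fst t \<union> snd t) * Q ^ card (fst t \<union> snd t)) * M\<^sup>2"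
      unfolding R_def a using fint[OF a(2)]
      by (simp add: card_cartesian_product card_PiE power2_eq_square del: finite_Un)
    also have "\<dots> \<le> (Q ^ (2 * w) * Q ^ (2 * w)) * M\<^sup>2"
      using c Q_pos by (intro mult_right_mono mult_mono power_increasing) auto
    also have "Q ^ (2 * w) * Q ^ (2 * w) = Q ^ (4 * w)" by (simp flip: power_add)
    finally show ?thesis .
  qed
  have "card keys \<le> card (Sigma ?A R)"
    using finS sub by (rule card_mono)
  also have "\<dots> = (\<Sum>a\<in>?A. card (R a))" using finA finR by (intro card_SigmaI ballI)
  also have "\<dots> \<le> (\<Sum>a\<in>?A. Q ^ (4 * w) * M\<^sup>2)" by (intro sum_mono cR)
  also have "\<dots> = card B * card small_pairs * (Q ^ (4 * w) * M\<^sup>2)"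
    by (simp only: sum_constant card_cartesian_product[of B] of_nat_id)
  also have "\<dots> \<le> card B * M * (Q ^ (4 * w) * M\<^sup>2)"
    using card_small_pairs by (intro mult_right_mono mult_left_mono) auto
  finally show "card keys \<le> card B * M ^ 3 * Q ^ (4 * w)"
    by (simp add: power2_eq_square power3_eq_cube mult_ac)
qed

text \<open>If, for some cell, the words over which most contents occur had density at least
  \<open>2 ^ - K\<close>, a matching pair would exist. Otherwise these words are negligible even
  after a union over at most \<open>2 ^ m\<close> cells, which costs \<open>m\<close> in the
  exponent. Over every other word each cell loses a factor 2, and there are at least
  \<open>K0 + 2\<close> cells.\<close>

lemma dense_match:
  assumes S: "S \<subseteq> V" and dens: "card V \<le> card S * 2 ^ K0"
    and B: "K0 + 2 \<le> card B" "card B \<le> 2 ^ m" and K: "K0 + 1 + m \<le> K"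
  shows "\<exists>b\<in>B. \<exists>t\<in>trm b. \<exists>s\<in>S. \<exists>s'\<in>S. matches b t s s'"
proof (rule ccontr)
  assume no: "\<not> ?thesis"
  \<comment> \<open>\<open>P b u\<close> holds the contents of cell \<open>b\<close> seen in
    \<open>S\<close> over the word \<open>u\<close>; \<open>U b\<close> holds the words for which
    these are more than half of all contents.\<close>
  define P where "P = (\<lambda>b u. {c b | c. (u, c) \<in> S})"
  define U where "U = (\<lambda>b. {u \<in> I \<rightarrow>\<^sub>E {..<Q}. M < 2 * card (P b u)})"
  have SV: "u \<in> I \<rightarrow>\<^sub>E {..<Q}" "c \<in> B \<rightarrow>\<^sub>E {..<M}" if "(u, c) \<in> S" for u c
    using that S by (auto simp: V_def)
  have PM: "P b u \<subseteq> {..<M}" if "b \<in> B" for b u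
    using that PiE_mem[OF SV(2)] by (auto simp: P_def)
  have finX: "finite (I \<rightarrow>\<^sub>E {..<Q})" using finite_I by (intro finite_PiE) simp_all
  have finU: "finite (U b)" for b unfolding U_def using finX by simp
  have Usmall: "card (U b) * 2 ^ K < Q ^ card I" if b: "b \<in> B" for b
  proof (rule ccontr)
    assume "\<not> ?thesis"
    then have large: "Q ^ card I \<le> card (U b) * 2 ^ K" by simp
    have "U b \<subseteq> I \<rightarrow>\<^sub>E {..<Q}" "2 * w < Q" by (auto simp: U_def Q_def)
    from dense_pair[OF finite_I J_subset[OF b] this large]
    obtain T where T: "T \<subseteq> I - J b" "card T \<le> K"
      "\<And>D. D \<subseteq> I - (J b \<union> T) \<Longrightarrow> card D \<le> w \<Longrightarrow>
        \<exists>u\<in>U b. \<exists>u'\<in>U b. (\<forall>x\<in>J b. u x = u' x) \<and> (\<forall>x\<in>D. u x \<noteq> u' x)"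
      by (elim exE conjE) (metis (no_types, lifting))
    obtain E D where t: "(E, D) \<in> trm b" "E \<subseteq> J b" "D \<inter> (J b \<union> T) = {}"
      using robust[OF b T(1,2)] by blast
    have "D \<subseteq> I - (J b \<union> T)" "card D \<le> w" using trm[OF b t(1)] t(3) by auto
    then obtain u u' where u: "u \<in> U b" "u' \<in> U b" "\<forall>x\<in>J b. u x = u' x" "\<forall>x\<in>D. u x \<noteq> u' x"
      using T(3) by blast
    \<comment> \<open>Both words see more than half of the residues in cell \<open>b\<close>, so
      their contents can be chosen to add up to any prescribed code.\<close>
    have "\<exists>a\<in>P b u. \<exists>a'\<in>P b u'. (a + a') mod M = code (E, D)"
      using u(1,2) PM[OF b] code(2)[OF trm_small[OF b t(1)]]
      by (intro two_large_sets_sum) (auto simp: U_def)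
    then obtain c c' where c: "(u, c) \<in> S" "(u', c') \<in> S" "(c b + c' b) mod M = code (E, D)"
      by (auto simp: P_def)
    have "matches b (E, D) (u, c) (u', c')"
      using u(3,4) t(2) c(3) by (auto simp: matches_def)
    then show False using no b t(1) c(1,2) by blast
  qed
  \<comment> \<open>Outside \<open>W\<close> every cell takes at most half of its possible contents, so the fibres of \<open>S\<close> are tiny.\<close>
  define W where "W = (\<Union>b\<in>B. U b)"
  define A where "A = Q ^ card I"
  define N where "N = M ^ card B"
  have finW: "finite W" unfolding W_def using finite_B finU by blast
  have "B \<noteq> {}" using B(1) by auto
  have "card W \<le> (\<Sum>b\<in>B. card (U b))" unfolding W_def by (rule card_UN_le[OF finite_B])
  then have "card W * 2 ^ K \<le> (\<Sum>b\<in>B. card (U b) * 2 ^ K)"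
    by (simp add: sum_distrib_right[symmetric])
  also have "\<dots> \<le> (\<Sum>b\<in>B. A)"
    using Usmall by (intro sum_mono) (simp add: A_def less_imp_le)
  also have "\<dots> \<le> A * 2 ^ m" using B(2) by simp
  finally have "card W * 2 ^ K \<le> A * 2 ^ m" .
  moreover have "card W * 2 ^ (K0 + 1 + m) \<le> card W * 2 ^ K"
    using K by (intro mult_left_mono power_increasing) auto
  ultimately have "card W * 2 ^ (K0 + 1 + m) \<le> A * 2 ^ m" by (rule order_trans[rotated])
  then have "(card W * 2 ^ (K0 + 1)) * 2 ^ m \<le> A * 2 ^ m"
    by (simp only: power_add mult.assoc)
  then have W: "card W * 2 ^ (K0 + 1) \<le> A" by (simp only: mult_le_cancel2) simp
  define fib where "fib = (\<lambda>u. if u \<in> W then {} else {c. (u, c) \<in> S})"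
  have fib_small: "card (fib u) * 2 ^ card B \<le> N" if u: "u \<in> I \<rightarrow>\<^sub>E {..<Q}" for u
  proof (cases "u \<in> W")
    case False
    have P2: "2 * card (P b u) \<le> M" if "b \<in> B" for b
      using False that u by (auto simp: W_def U_def not_less)
    have "{c. (u, c) \<in> S} \<subseteq> (\<Pi>\<^sub>E b\<in>B. P b u)"
    proof
      fix c assume "c \<in> {c. (u, c) \<in> S}"
      then show "c \<in> (\<Pi>\<^sub>E b\<in>B. P b u)"
        using PiE_arb[OF SV(2)] by (intro PiE_I) (auto simp: P_def)
    qed
    moreover have "finite (\<Pi>\<^sub>E b\<in>B. P b u)"
      using finite_B PM by (intro finite_PiE) (auto intro: finite_subset)
    ultimately have "card (fib u) \<le> card (\<Pi>\<^sub>E b\<in>B. P b u)"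
      using False by (simp add: fib_def card_mono)
    also have "\<dots> = (\<Prod>b\<in>B. card (P b u))" using finite_B by (rule card_PiE)
    finally have "card (fib u) * 2 ^ card B \<le> (\<Prod>b\<in>B. card (P b u)) * (\<Prod>b\<in>B. 2)" by simp
    also have "\<dots> = (\<Prod>b\<in>B. card (P b u) * 2)" by (rule prod.distrib[symmetric])
    also have "\<dots> \<le> (\<Prod>b\<in>B. M)" using P2 by (intro prod_mono) (simp add: mult.commute)
    finally show ?thesis by (simp add: N_def)
  qed (simp add: fib_def)
  have fin2: "finite (B \<rightarrow>\<^sub>E {..<M})" using finite_B by (intro finite_PiE) simp_all
  have finfib: "finite (fib u)" for u
    by (rule finite_subset[OF _ fin2]) (auto simp: fib_def dest: SV(2))
  have "S \<subseteq> W \<times> (B \<rightarrow>\<^sub>E {..<M}) \<union> Sigma (I \<rightarrow>\<^sub>E {..<Q}) fib"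
  proof
    fix s assume "s \<in> S"
    moreover obtain u c where "s = (u, c)" by (cases s)
    ultimately show "s \<in> W \<times> (B \<rightarrow>\<^sub>E {..<M}) \<union> Sigma (I \<rightarrow>\<^sub>E {..<Q}) fib"
      using SV[of u c] by (cases "u \<in> W") (simp_all add: fib_def)
  qed
  then have "card S \<le> card (W \<times> (B \<rightarrow>\<^sub>E {..<M}) \<union> Sigma (I \<rightarrow>\<^sub>E {..<Q}) fib)"
    using finW fin2 finX finfib by (intro card_mono finite_UnI finite_SigmaI) simp_all
  also have "\<dots> \<le> card (W \<times> (B \<rightarrow>\<^sub>E {..<M})) + card (Sigma (I \<rightarrow>\<^sub>E {..<Q}) fib)"
    by (rule card_Un_le)
  also have "\<dots> = card W * N + (\<Sum>u\<in>I \<rightarrow>\<^sub>E {..<Q}. card (fib u))"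
    using finX finfib finite_B by (simp add: card_cartesian_product card_PiE N_def)
  finally have "card S \<le> card W * N + (\<Sum>u\<in>I \<rightarrow>\<^sub>E {..<Q}. card (fib u))" .
  moreover have "(\<Sum>u\<in>I \<rightarrow>\<^sub>E {..<Q}. card (fib u)) * 2 ^ (K0 + 2) \<le> A * N"
  proof -
    have "(\<Sum>u\<in>I \<rightarrow>\<^sub>E {..<Q}. card (fib u)) * 2 ^ (K0 + 2) \<le> (\<Sum>u\<in>I \<rightarrow>\<^sub>E {..<Q}. card (fib u)) * 2 ^ card B"
      using B(1) by (intro mult_left_mono power_increasing) auto
    also have "\<dots> = (\<Sum>u\<in>I \<rightarrow>\<^sub>E {..<Q}. card (fib u) * 2 ^ card B)" by (rule sum_distrib_right)
    also have "\<dots> \<le> (\<Sum>u\<in>I \<rightarrow>\<^sub>E {..<Q}. N)" by (intro sum_mono fib_small)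
    also have "\<dots> = A * N" using finite_I by (simp add: card_PiE A_def)
    finally show ?thesis .
  qed
  moreover have "card W * 2 ^ (K0 + 1) * N \<le> A * N" using W by simp
  \<comment> \<open>Relative to \<open>2 ^ - K0\<close>, the words in \<open>W\<close> contribute
    density at most 1/2 and the small fibres at most 1/4, in total 3/4.\<close>
  ultimately have "4 * (card S * 2 ^ K0) \<le> 3 * (A * N)"
  proof -
    let ?F = "\<Sum>u\<in>I \<rightarrow>\<^sub>E {..<Q}. card (fib u)"
    assume *: "card S \<le> card W * N + ?F" "?F * 2 ^ (K0 + 2) \<le> A * N" "card W * 2 ^ (K0 + 1) * N \<le> A * N"
    have "4 * (card S * 2 ^ K0) \<le> 4 * ((card W * N + ?F) * 2 ^ K0)" using *(1) by simp
    also have "\<dots> = 2 * (card W * 2 ^ (K0 + 1) * N) + ?F * 2 ^ (K0 + 2)"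
      by (simp add: algebra_simps)
    also have "\<dots> \<le> 3 * (A * N)" using *(2,3) by linarith
    finally show ?thesis .
  qed
  also have "\<dots> < 4 * (A * N)" using Q_pos M_pos by (simp add: A_def N_def)
  also have "A * N = card V" by (simp add: A_def N_def card_V)
  finally show False using dens by simp
qed

lemma term_system_graph:
  assumes "K0 + 2 \<le> card B" "card B \<le> 2 ^ m" "K0 + 1 + m \<le> K" "Q ^ card I * M ^ card B \<le> n"
  shows "\<exists>E. simple_graph n E \<and> bp n E \<le> card B * M ^ 3 * Q ^ (4 * w) \<and> 2 ^ K0 \<le> chromatic_number n E"
proof -
  have "card V \<noteq> 0" using Q_pos M_pos by (simp add: card_V)
  then have "V \<noteq> {}" by auto
  have sub: "left \<kappa> \<subseteq> V" "right \<kappa> \<subseteq> V" for \<kappa>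
    by (auto simp: left_def right_def endpoints_def split: prod.splits)
  have disj: "left \<kappa> \<inter> right \<kappa> = {}" if \<kappa>: "\<kappa> \<in> keys" for \<kappa>
  proof -
    obtain b t f g c d where *: "\<kappa> = ((b, t), f, g, c, d)" by (metis prod.exhaust)
    show ?thesis using keysD(4)[OF \<kappa>[unfolded *]] unfolding * by blast
  qed
  have dense: "\<exists>\<kappa>\<in>keys. \<exists>x\<in>S. \<exists>y\<in>S. x \<in> left \<kappa> \<and> y \<in> right \<kappa>"
    if S: "S \<subseteq> V" "card V \<le> card S * 2 ^ K0" for S
  proof -
    obtain b t s s' where "b \<in> B" "t \<in> trm b" "s \<in> S" "s' \<in> S" "matches b t s s'"
      using dense_match[OF S assms(1-3)] by blast
    then show ?thesis using matches_key[of b t s s'] S(1) by blast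
  qed
  have "card V \<le> n" using assms(4) by (simp add: card_V)
  have "\<exists>E. simple_graph n E \<and> bp n E \<le> card keys \<and> 2 ^ K0 \<le> chromatic_number n E"
  proof (rule biclique_family_graph[where X = left and Y = right and V = V])
    fix \<kappa> \<kappa>' x y
    assume "\<kappa> \<in> keys" "\<kappa>' \<in> keys" "x \<in> left \<kappa>" "y \<in> right \<kappa>"
      "(x \<in> left \<kappa>' \<and> y \<in> right \<kappa>') \<or> (y \<in> left \<kappa>' \<and> x \<in> right \<kappa>')"
    then show "\<kappa> = \<kappa>'" by (rule keys_unique)
  qed (use finite_V \<open>V \<noteq> {}\<close> \<open>card V \<le> n\<close> card_keys(1) sub disj dense in blast)+
  then show ?thesis using card_keys(2) by (meson order_trans)
qed

end

section \<open>Almost disjoint functions and hitting sets\<close>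

text \<open>Union bound over the \<open>s\<close>-element sets of agreement: each leaves
  \<open>q ^ (q - s)\<close> functions, and \<open>q choose s\<close> is at most
  \<open>q ^ s / fact s\<close>.\<close>

lemma card_agreeing_functions:
  fixes f :: "nat \<Rightarrow> nat"
  assumes "\<And>x. x < q \<Longrightarrow> f x < q"
  shows "card {g \<in> {..<q} \<rightarrow>\<^sub>E {..<q}. s \<le> card {x. x < q \<and> g x = f x}} * fact s \<le> q ^ q"
proof (cases "s \<le> q")
  case False
  have "card {x. x < q \<and> g x = f x} \<le> q" for g :: "nat \<Rightarrow> nat"
    using card_mono[of "{..<q}" "{x. x < q \<and> g x = f x}"] by auto
  then have "{g \<in> {..<q} \<rightarrow>\<^sub>E {..<q}. s \<le> card {x. x < q \<and> g x = f x}} = {}"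
    using False by (auto intro: order_trans)
  then show ?thesis by (simp only: card.empty)
next
  case True
  define \<A> where "\<A> = {A. A \<subseteq> {..<q} \<and> card A = s}"
  have finA: "finite \<A>" unfolding \<A>_def by simp
  have cardA: "card \<A> = q choose s"
    unfolding \<A>_def using n_subsets[of "{..<q}" s] by simp
  define Z where "Z = (\<lambda>A. \<Pi>\<^sub>E x\<in>{..<q}. if x \<in> A then {f x} else {..<q})"
  have finZ: "finite (Z A)" for A unfolding Z_def by (intro finite_PiE) auto
  have cardZ: "card (Z A) = q ^ (q - s)" if "A \<in> \<A>" for A
  proof -
    have A: "A \<subseteq> {..<q}" "card A = s" using that by (auto simp: \<A>_def)
    have "card (Z A) = (\<Prod>x<q. card (if x \<in> A then {f x} else {..<q}))"
      unfolding Z_def by (simp add: card_PiE)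
    also have "\<dots> = (\<Prod>x<q. if x \<in> A then 1 else q)"
      by (intro prod.cong) auto
    also have "\<dots> = (\<Prod>x\<in>{..<q} - A. q)"
      by (intro prod.mono_neutral_cong_right) auto
    also have "\<dots> = q ^ (q - s)"
      using A by (simp add: card_Diff_subset finite_subset)
    finally show ?thesis .
  qed
  have "{g \<in> {..<q} \<rightarrow>\<^sub>E {..<q}. s \<le> card {x. x < q \<and> g x = f x}} \<subseteq> (\<Union>A\<in>\<A>. Z A)"
  proof
    fix g assume "g \<in> {g \<in> {..<q} \<rightarrow>\<^sub>E {..<q}. s \<le> card {x. x < q \<and> g x = f x}}"
    then have g: "g \<in> {..<q} \<rightarrow>\<^sub>E {..<q}" "s \<le> card {x. x < q \<and> g x = f x}" by auto
    then obtain A where A: "A \<subseteq> {x. x < q \<and> g x = f x}" "card A = s"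
      by (meson obtain_subset_with_card_n)
    then have "A \<in> \<A>" "g \<in> Z A"
      using g(1) by (auto simp: \<A>_def Z_def PiE_iff)
    then show "g \<in> (\<Union>A\<in>\<A>. Z A)" by blast
  qed
  then have "card {g \<in> {..<q} \<rightarrow>\<^sub>E {..<q}. s \<le> card {x. x < q \<and> g x = f x}} \<le> card (\<Union>A\<in>\<A>. Z A)"
    by (intro card_mono) (auto simp: finA finZ)
  also have "\<dots> \<le> (\<Sum>A\<in>\<A>. card (Z A))" by (rule card_UN_le[OF finA])
  also have "\<dots> = (q choose s) * q ^ (q - s)" using cardZ cardA by simp
  finally have "card {g \<in> {..<q} \<rightarrow>\<^sub>E {..<q}. s \<le> card {x. x < q \<and> g x = f x}} * fact s
      \<le> ((q choose s) * q ^ (q - s)) * fact s" by (rule mult_right_mono) simp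
  also have "\<dots> = ((q choose s) * fact s) * q ^ (q - s)" by simp
  also have "\<dots> \<le> q ^ s * q ^ (q - s)"
    by (intro mult_right_mono) (use binomial_fact_pow[of q s] in auto)
  also have "\<dots> = q ^ q" using True by (simp flip: power_add)
  finally show ?thesis .
qed

text \<open>The greedy argument of Gilbert and Varshamov.\<close>

lemma exists_almost_disjoint_functions:
  assumes "0 < q" "N \<le> fact (Suc l)"
  shows "\<exists>F :: nat \<Rightarrow> nat \<Rightarrow> nat. (\<forall>a<N. \<forall>x<q. F a x < q) \<and>
    (\<forall>a<N. \<forall>a'<N. a \<noteq> a' \<longrightarrow> card {x. x < q \<and> F a x = F a' x} \<le> l)"
  using assms(2)
proof (induction N)
  case 0
  show ?case by simp
next
  case (Suc N)
  then obtain F :: "nat \<Rightarrow> nat \<Rightarrow> nat" where F: "\<And>a x. a < N \<Longrightarrow> x < q \<Longrightarrow> F a x < q"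
    "\<And>a a'. a < N \<Longrightarrow> a' < N \<Longrightarrow> a \<noteq> a' \<Longrightarrow> card {x. x < q \<and> F a x = F a' x} \<le> l"
    by (metis Suc_leD)
  define Z where "Z = (\<lambda>a. {g \<in> {..<q} \<rightarrow>\<^sub>E {..<q}. Suc l \<le> card {x. x < q \<and> g x = F a x}})"
  \<comment> \<open>Each \<open>Z a\<close> has density at most \<open>1 / fact (Suc l)\<close>, so
    fewer than \<open>fact (Suc l)\<close> of them cannot exhaust all functions.\<close>
  have "card (\<Union>a<N. Z a) * fact (Suc l) \<le> (\<Sum>a<N. card (Z a)) * fact (Suc l)"
    by (intro mult_right_mono card_UN_le) auto
  also have "\<dots> = (\<Sum>a<N. card (Z a) * fact (Suc l))" by (rule sum_distrib_right)
  also have "\<dots> \<le> (\<Sum>a<N. q ^ q)"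
    by (intro sum_mono) (use F(1) in \<open>auto simp: Z_def intro!: card_agreeing_functions simp del: fact_Suc\<close>)
  also have "\<dots> = N * q ^ q" by simp
  also have "\<dots> < fact (Suc l) * q ^ q"
    using Suc.prems assms(1) by (intro mult_strict_right_mono) auto
  finally have "card (\<Union>a<N. Z a) < q ^ q"
    by (metis mult.commute mult_less_cancel2)
  also have "q ^ q = card ({..<q} \<rightarrow>\<^sub>E {..<q})" by (simp add: card_PiE)
  finally have "\<not> ({..<q} \<rightarrow>\<^sub>E {..<q}) \<subseteq> (\<Union>a<N. Z a)"
    using card_mono[of "\<Union>a<N. Z a" "{..<q} \<rightarrow>\<^sub>E {..<q}"] by (auto simp: Z_def finite_PiE)
  then obtain g where g: "g \<in> {..<q} \<rightarrow>\<^sub>E {..<q}" "\<And>a. a < N \<Longrightarrow> g \<notin> Z a" by blast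
  then have g': "card {x. x < q \<and> g x = F a x} \<le> l" if "a < N" for a
    using that by (fastforce simp: Z_def)
  then have g'': "card {x. x < q \<and> F a x = g x} \<le> l" if "a < N" for a
    using that by (simp add: eq_commute)
  have "\<forall>a<Suc N. \<forall>x<q. (F(N := g)) a x < q"
    using F(1) g(1) by (auto simp: less_Suc_eq)
  moreover have "\<forall>a<Suc N. \<forall>a'<Suc N. a \<noteq> a' \<longrightarrow>
      card {x. x < q \<and> (F(N := g)) a x = (F(N := g)) a' x} \<le> l"
    using F(2) g' g'' by (auto simp: less_Suc_eq)
  ultimately show ?case by blast
qed

text \<open>A Bonferroni bound, doubled to avoid halves: a set added to the union loses at most
  \<open>l\<close> points to each earlier one.\<close>

lemma card_Union_almost_disjoint:
  assumes "finite \<A>" "\<And>a. a \<in> \<A> \<Longrightarrow> finite (G a)" "\<And>a. a \<in> \<A> \<Longrightarrow> h \<le> card (G a)"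
    and "\<And>a a'. a \<in> \<A> \<Longrightarrow> a' \<in> \<A> \<Longrightarrow> a \<noteq> a' \<Longrightarrow> card (G a \<inter> G a') \<le> l"
  shows "2 * card \<A> * h \<le> 2 * card (\<Union>a\<in>\<A>. G a) + l * (card \<A>)\<^sup>2"
  using assms
proof (induction \<A> rule: finite_induct)
  case empty
  then show ?case by simp
next
  case (insert a \<A>)
  let ?U = "\<Union>a\<in>\<A>. G a"
  have "card (G a \<inter> ?U) = card (\<Union>a'\<in>\<A>. G a \<inter> G a')" by (rule arg_cong[of _ _ card]) blast
  also have "\<dots> \<le> (\<Sum>a'\<in>\<A>. card (G a \<inter> G a'))" by (rule card_UN_le[OF insert.hyps(1)])
  also have "\<dots> \<le> (\<Sum>a'\<in>\<A>. l)"
    using insert by (intro sum_mono) auto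
  finally have int: "card (G a \<inter> ?U) \<le> l * card \<A>" by (simp add: mult.commute)
  have "finite ?U" using insert by auto
  then have "card (G a) + card ?U = card (G a \<union> ?U) + card (G a \<inter> ?U)"
    using insert.prems(1) by (intro card_Un_Int) auto
  then have "h + card ?U \<le> card (\<Union>a\<in>insert a \<A>. G a) + l * card \<A>"
    using int insert.prems(2)[of a] by simp
  moreover have "2 * card \<A> * h \<le> 2 * card ?U + l * (card \<A>)\<^sup>2"
    using insert by simp
  ultimately show ?case
    using insert.hyps by (simp add: power2_eq_square algebra_simps)
qed

text \<open>Every set has density at least \<open>1 / d\<close> in \<open>P\<close>, so some point
  hits a fraction \<open>1 / d\<close> of the sets not yet hit. After \<open>t\<close> choices fewer
  than one set remains.\<close>

lemma greedy_hitting_set: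
  assumes "finite \<A>" "finite P" "\<And>a. a \<in> \<A> \<Longrightarrow> G a \<subseteq> P \<and> G a \<noteq> {} \<and> card P \<le> d * card (G a)"
    and small: "card \<A> * (d - 1) ^ t < d ^ t"
  shows "\<exists>H \<subseteq> P. card H \<le> t \<and> (\<forall>a\<in>\<A>. G a \<inter> H \<noteq> {})"
proof -
  define unhit where "unhit = (\<lambda>H. {a \<in> \<A>. G a \<inter> H = {}})"
  have "\<exists>H \<subseteq> P. card H \<le> s \<and> card (unhit H) * d ^ s \<le> card \<A> * (d - 1) ^ s" for s
  proof (induction s)
    case 0
    show ?case by (intro exI[of _ "{}"]) (simp add: unhit_def)
  next
    case (Suc s)
    then obtain H where H: "H \<subseteq> P" "card H \<le> s" "card (unhit H) * d ^ s \<le> card \<A> * (d - 1) ^ s"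
      by blast
    define A' where "A' = unhit H"
    have A': "A' \<subseteq> \<A>" "finite A'" using assms(1) by (auto simp: A'_def unhit_def)
    show ?case
    proof (cases "A' = {}")
      case True
      then show ?thesis using H by (intro exI[of _ H]) (auto simp: A'_def)
    next
      case False
      then have "P \<noteq> {}" using assms(3) A' by blast
      define cnt where "cnt = (\<lambda>p. card {a \<in> A'. p \<in> G a})"
      \<comment> \<open>Double counting of incidences between points and unhit sets.\<close>
      have "\<exists>p\<in>P. card A' \<le> d * cnt p"
      proof (rule ccontr)
        assume "\<not> ?thesis"
        then have "(\<Sum>p\<in>P. d * cnt p) < (\<Sum>p\<in>P. card A')"
          using \<open>P \<noteq> {}\<close> assms(2) by (intro sum_strict_mono) auto
        also have "\<dots> = (\<Sum>a\<in>A'. card P)" by simp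
        also have "\<dots> \<le> (\<Sum>a\<in>A'. d * card (G a))"
          using assms(3) A' by (intro sum_mono) auto
        also have "\<dots> = d * (\<Sum>a\<in>A'. \<Sum>p\<in>P. of_bool (p \<in> G a))"
          unfolding sum_distrib_left[symmetric]
          using assms(2,3) A' by (intro arg_cong2[of _ _ _ _ "(*)"] refl sum.cong) (auto simp: Int_absorb1 Int_commute subset_iff intro!: arg_cong[of _ _ card])
        also have "\<dots> = d * (\<Sum>p\<in>P. \<Sum>a\<in>A'. of_bool (p \<in> G a))"
          by (subst sum.swap) simp
        also have "\<dots> = (\<Sum>p\<in>P. d * cnt p)"
          using A' by (simp add: sum_distrib_left cnt_def Int_def)
        finally show False by simp
      qed
      then obtain p where p: "p \<in> P" "card A' \<le> d * cnt p" by blast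
      have "unhit (insert p H) = A' - {a \<in> A'. p \<in> G a}"
        by (auto simp: unhit_def A'_def)
      then have "card (unhit (insert p H)) = card A' - cnt p"
        using A' by (simp add: cnt_def card_Diff_subset)
      then have "d * card (unhit (insert p H)) \<le> (d - 1) * card A'"
        using p(2) by (simp add: diff_mult_distrib diff_mult_distrib2)
      then have "card (unhit (insert p H)) * d ^ Suc s \<le> (d - 1) * (card A' * d ^ s)"
        using mult_right_mono[of "d * card (unhit (insert p H))" "(d - 1) * card A'" "d ^ s"]
        by (simp add: mult_ac)
      also have "\<dots> \<le> (d - 1) * (card \<A> * (d - 1) ^ s)"
        using H(3) unfolding A'_def by (rule mult_left_mono) simp
      finally have "card (unhit (insert p H)) * d ^ Suc s \<le> card \<A> * (d - 1) ^ Suc s"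
        by (simp add: mult_ac)
      moreover have "card (insert p H) \<le> Suc s"
        using H(1,2) assms(2) by (simp add: card_insert_if finite_subset)
      ultimately show ?thesis using H(1) p(1) by (intro exI[of _ "insert p H"]) auto
    qed
  qed
  then obtain H where H: "H \<subseteq> P" "card H \<le> t" "card (unhit H) * d ^ t \<le> card \<A> * (d - 1) ^ t"
    by blast
  then have "card (unhit H) * d ^ t < 1 * d ^ t" using small by linarith
  then have "card (unhit H) = 0" by (simp only: mult_less_cancel2) simp
  then have "unhit H = {}" using assms(1) by (simp add: unhit_def)
  then show ?thesis using H(1,2) by (auto simp: unhit_def)
qed

text \<open>Says that \<open>d\<close> greedy steps halve the number of unhit sets. With
  \<open>e = d - 1\<close>, Bernoulli gives \<open>(1 + 1 / e) ^ d >= 2\<close>.\<close>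

lemma two_mult_pred_power_le: "0 < d \<Longrightarrow> 2 * (d - 1) ^ d \<le> (d::nat) ^ d"
proof -
  assume "0 < d"
  then obtain e where d: "d = Suc e" by (cases d) auto
  show ?thesis
  proof (cases "e = 0")
    case False
    have "2 \<le> 1 + real (Suc e) * (1 / real e)" using False by (simp add: field_simps)
    also have "\<dots> \<le> (1 + 1 / real e) ^ Suc e" by (rule Bernoulli_inequality) (simp add: order.trans[of _ 0])
    finally have "2 * real e ^ Suc e \<le> (real e * (1 + 1 / real e)) ^ Suc e"
      using mult_left_mono[of 2 "(1 + 1 / real e) ^ Suc e" "real e ^ Suc e"]
      unfolding power_mult_distrib by (simp only: mult.commute zero_le_power of_nat_0_le_iff)
    also have "real e * (1 + 1 / real e) = real (Suc e)" using False by (simp add: field_simps)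
    finally have "real (2 * e ^ Suc e) \<le> real (Suc e ^ Suc e)"
      by (simp only: of_nat_mult of_nat_power of_nat_numeral)
    then show ?thesis using d by (simp only: of_nat_le_iff diff_Suc_1)
  qed (simp add: d)
qed

text \<open>Two graphs of functions \<open>F a\<close> meet in few points, so the small set \<open>T\<close> can contain half of only a few of them;
  those are collected in \<open>W\<close>, and the others have many points outside \<open>T\<close> and admit a small hitting set \<open>H\<close> there.\<close>

lemma exists_transversal_outside:
  assumes F: "\<And>a x. a < q\<^sup>2 \<Longrightarrow> x < q \<Longrightarrow> F a x < q"
    and meet: "\<And>a a'. a < q\<^sup>2 \<Longrightarrow> a' < q\<^sup>2 \<Longrightarrow> a \<noteq> a' \<Longrightarrow> card {x. x < q \<and> F a x = F a' x} \<le> 14 * l"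
    and q: "q = 32 * k * l" "q\<^sup>2 \<le> 2 ^ (14 * l)" "0 < k" "0 < l"
    and T: "T \<subseteq> {..<q} \<times> {..<q}" "card T < 9 * k\<^sup>2 * l"
  shows "\<exists>H W. H \<subseteq> {..<q} \<times> {..<q} - T \<and> H \<noteq> {} \<and> card H \<le> 30 * q * l \<and>
    W \<subseteq> {..<q\<^sup>2} \<and> card W \<le> 30 * q * l \<and> (\<forall>a<q\<^sup>2. a \<in> W \<or> (\<exists>x<q. (x, F a x) \<in> H))"
proof -
  define G where "G = (\<lambda>a. (\<lambda>x. (x, F a x)) ` {..<q})"
  have finG: "finite (G a)" for a by (simp add: G_def)
  have cardG: "card (G a) = q" for a
    unfolding G_def by (subst card_image) (auto simp: inj_on_def)
  have Gsub: "G a \<subseteq> {..<q} \<times> {..<q}" if "a < q\<^sup>2" for a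
    using F[OF that] by (auto simp: G_def)
  have finT: "finite T" using T(1) by (rule finite_subset) simp
  have Gmeet: "card (G a \<inter> G a') \<le> 14 * l" if "a < q\<^sup>2" "a' < q\<^sup>2" "a \<noteq> a'" for a a'
  proof -
    have "G a \<inter> G a' = (\<lambda>x. (x, F a x)) ` {x. x < q \<and> F a x = F a' x}"
      by (auto simp: G_def)
    then have "card (G a \<inter> G a') \<le> card {x. x < q \<and> F a x = F a' x}"
      by (simp add: card_image_le)
    then show ?thesis using meet[OF that] by simp
  qed
  define W where "W = {a. a < q\<^sup>2 \<and> q \<le> 2 * card (G a \<inter> T)}"
  have finW: "finite W" by (simp add: W_def)
  \<comment> \<open>Otherwise \<open>k\<close> graphs would each have
    \<open>q / 2 = 16 * k * l\<close> points in \<open>T\<close> and meet pairwise in at most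
    \<open>14 * l\<close>, forcing at least \<open>(32 - 14) / 2 = 9\<close> times
    \<open>k^2 * l\<close> points into \<open>T\<close>.\<close>
  have "card W < k"
  proof (rule ccontr)
    assume "\<not> ?thesis"
    then have "k \<le> card W" by simp
    then obtain A where A: "A \<subseteq> W" "card A = k" "finite A"
      by (rule obtain_subset_with_card_n)
    have "2 * card A * (16 * k * l) \<le> 2 * card (\<Union>a\<in>A. G a \<inter> T) + 14 * l * (card A)\<^sup>2"
    proof (rule card_Union_almost_disjoint)
      fix a assume "a \<in> A"
      then show "finite (G a \<inter> T)" "16 * k * l \<le> card (G a \<inter> T)"
        using A(1) q(1) finT by (auto simp: W_def)
    next
      fix a a' assume "a \<in> A" "a' \<in> A" "a \<noteq> a'"
      then have "card (G a \<inter> G a') \<le> 14 * l" using A(1) by (intro Gmeet) (auto simp: W_def)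
      moreover have "card ((G a \<inter> T) \<inter> (G a' \<inter> T)) \<le> card (G a \<inter> G a')"
        using finG by (intro card_mono) auto
      ultimately show "card ((G a \<inter> T) \<inter> (G a' \<inter> T)) \<le> 14 * l" by simp
    qed fact
    moreover have "card (\<Union>a\<in>A. G a \<inter> T) \<le> card T" using finT by (intro card_mono) auto
    ultimately have "32 * (k\<^sup>2 * l) \<le> 2 * card T + 14 * (k\<^sup>2 * l)"
      using A(2) by (simp add: power2_eq_square mult_ac)
    then show False using T(2) by (simp add: mult_ac)
  qed
  \<comment> \<open>A graph outside \<open>W\<close> keeps more than \<open>q / 2\<close> of the at
    most \<open>q^2\<close> points off \<open>T\<close>, that is density at least
    \<open>1 / (2 * q)\<close>. Then \<open>15 * l\<close> halvings, of \<open>d\<close> steps each,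
    exhaust the at most \<open>2 ^ (14 * l)\<close> graphs.\<close>
  define d where "d = 2 * q"
  have "0 < q" using q by simp
  have "\<exists>H \<subseteq> {..<q} \<times> {..<q} - T. card H \<le> d * (15 * l) \<and> (\<forall>a\<in>{..<q\<^sup>2} - W. (G a - T) \<inter> H \<noteq> {})"
  proof (rule greedy_hitting_set)
    fix a assume a: "a \<in> {..<q\<^sup>2} - W"
    then have "2 * card (G a \<inter> T) < q" by (auto simp: W_def not_le)
    moreover have "card (G a \<inter> T) + card (G a - T) = q"
      using card_Int_Diff[OF finG, of a T] cardG by simp
    ultimately have h: "q < 2 * card (G a - T)" by linarith
    have "card ({..<q} \<times> {..<q} - T) \<le> card ({..<q} \<times> {..<q})" by (intro card_mono) auto
    also have "\<dots> = q * q" by (simp add: card_cartesian_product)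
    also have "\<dots> \<le> q * (2 * card (G a - T))" using h by (intro mult_left_mono) auto
    finally have "card ({..<q} \<times> {..<q} - T) \<le> d * card (G a - T)" by (simp add: d_def mult_ac)
    moreover have "G a - T \<subseteq> {..<q} \<times> {..<q} - T" using Gsub a by auto
    moreover have "G a - T \<noteq> {}" using h by (metis card.empty mult_0_right not_less_zero)
    ultimately show "G a - T \<subseteq> {..<q} \<times> {..<q} - T \<and> G a - T \<noteq> {} \<and>
        card ({..<q} \<times> {..<q} - T) \<le> d * card (G a - T)" by blast
  next
    have "(2 * (d - 1) ^ d) ^ (15 * l) \<le> (d ^ d) ^ (15 * l)"
      using \<open>0 < q\<close> by (intro power_mono two_mult_pred_power_le) (simp_all add: d_def)
    then have le: "2 ^ (15 * l) * (d - 1) ^ (d * (15 * l)) \<le> d ^ (d * (15 * l))"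
      by (simp add: power_mult_distrib power_mult[symmetric])
    have "card ({..<q\<^sup>2} - W) \<le> q\<^sup>2" using card_mono[of "{..<q\<^sup>2}" "{..<q\<^sup>2} - W"] by simp
    also have "\<dots> \<le> 2 ^ (14 * l)" by fact
    also have "\<dots> < 2 ^ (15 * l)" using q by (intro power_strict_increasing) auto
    finally have "card ({..<q\<^sup>2} - W) * (d - 1) ^ (d * (15 * l)) < 2 ^ (15 * l) * (d - 1) ^ (d * (15 * l))"
      using \<open>0 < q\<close> by (intro mult_strict_right_mono) (simp_all add: d_def)
    then show "card ({..<q\<^sup>2} - W) * (d - 1) ^ (d * (15 * l)) < d ^ (d * (15 * l))"
      using le by (rule less_le_trans)
  qed simp_all
  then obtain H where H: "H \<subseteq> {..<q} \<times> {..<q} - T" "card H \<le> d * (15 * l)"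
    "\<And>a. a < q\<^sup>2 \<Longrightarrow> a \<notin> W \<Longrightarrow> (G a - T) \<inter> H \<noteq> {}" by blast
  have kq: "k \<le> q" using q by simp
  have qq: "q \<le> q\<^sup>2" using \<open>0 < q\<close> by (simp add: power2_eq_square)
  have "\<not> {..<q\<^sup>2} \<subseteq> W" using card_mono[OF finW, of "{..<q\<^sup>2}"] \<open>card W < k\<close> kq qq by auto
  then have "H \<noteq> {}" using H(3) by blast
  moreover have "\<exists>x<q. (x, F a x) \<in> H" if "a < q\<^sup>2" "a \<notin> W" for a
    using H(3)[OF that] by (auto simp: G_def)
  moreover have "card W \<le> 30 * q * l" 
  proof -
    have "q * 1 \<le> q * (30 * l)" using q(4) by (intro mult_left_mono) auto
    then have "card W \<le> q * (30 * l)" using \<open>card W < k\<close> kq by linarith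
    then show ?thesis by (simp add: mult_ac)
  qed
  moreover have "card H \<le> 30 * q * l" using H(2) by (simp add: d_def mult_ac)
  moreover have "W \<subseteq> {..<q\<^sup>2}" by (auto simp: W_def)
  ultimately show ?thesis using H(1) by blast
qed

section \<open>Two conflicting kinds of certificates on a grid, and the term system formed by
  \<open>m\<close> copies\<close>

locale transversal_game =
  fixes q N t K m :: nat and F :: "nat \<Rightarrow> nat \<Rightarrow> nat"
  assumes F: "\<And>a x. a < N \<Longrightarrow> x < q \<Longrightarrow> F a x < q"
    and transversal: "\<And>T. T \<subseteq> {..<q} \<times> {..<q} \<Longrightarrow> card T \<le> K \<Longrightarrow>
      \<exists>H W. H \<subseteq> {..<q} \<times> {..<q} - T \<and> H \<noteq> {} \<and> card H \<le> t \<and> W \<subseteq> {..<N} \<and> card W \<le> t \<and>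
        (\<forall>a<N. a \<in> W \<or> (\<exists>x<q. (x, F a x) \<in> H))"
    and bounds: "K < N" "q \<le> t" "1 \<le> t" "1 \<le> m"
begin

text \<open>Each of \<open>m\<close> copies has a coordinate \<open>Inl a\<close> for every function \<open>F a\<close> and a coordinate \<open>Inr p\<close> for every
  point \<open>p\<close> of the grid. A cell is a set \<open>b\<close> of copies and prescribes which of two kinds of terms each copy accepts:
  ``differ at \<open>a\<close>, agree on the graph of \<open>F a\<close>'' for the copies in \<open>b\<close>, and for the others
  ``agree on \<open>W\<close>, differ on \<open>H\<close>'', where \<open>H\<close> meets the graph of every \<open>F a\<close> with \<open>a\<close> not in \<open>W\<close>.\<close>

definition coords :: "(nat \<times> (nat + nat \<times> nat)) set" where
  "coords = {..<m} \<times> ({..<N} <+> {..<q} \<times> {..<q})"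

text \<open>Plays the role of \<open>J b\<close>: in each copy it is the side on which the
  certificate built for \<open>b\<close> asks for agreement, the points of the grid for copies in
  \<open>b\<close> and the function indices for the others.\<close>

definition fixed :: "nat set \<Rightarrow> (nat \<times> (nat + nat \<times> nat)) set" where
  "fixed b = {(i, z) \<in> coords. i \<in> b \<longleftrightarrow> z \<in> range Inr}"

definition accepts :: "nat set \<Rightarrow> nat \<Rightarrow> (nat + nat \<times> nat) set \<Rightarrow> (nat + nat \<times> nat) set \<Rightarrow> bool" where
  "accepts b i E D \<longleftrightarrow> (if i \<in> b then \<exists>a<N. Inl a \<in> D \<and> (\<forall>x<q. Inr (x, F a x) \<in> E)
     else \<forall>a<N. Inl a \<in> E \<or> (\<exists>x<q. Inr (x, F a x) \<in> D))"

definition copy_terms :: "nat set \<Rightarrow>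
    ((nat \<times> (nat + nat \<times> nat)) set \<times> (nat \<times> (nat + nat \<times> nat)) set) set" where
  "copy_terms b = {(E, D). E \<subseteq> coords \<and> D \<subseteq> coords \<and> card E \<le> m * t \<and> card D \<le> m * t \<and> D \<noteq> {} \<and>
     (\<forall>i<m. accepts b i (E `` {i}) (D `` {i}))}"

lemma finite_coords: "finite coords" and card_coords: "card coords = m * (N + q * q)"
  unfolding coords_def by (simp_all add: card_cartesian_product card_Plus)

text \<open>The first certificate differs at some \<open>a\<close> and agrees on the graph of
  \<open>F a\<close>. The second either agrees at \<open>a\<close> or differs at a point of that
  graph.\<close>

lemma accepts_conflict:
  assumes "accepts b i E D" "accepts b' i E' D'" "i \<in> b" "i \<notin> b'"
  shows "E \<inter> D' \<noteq> {} \<or> D \<inter> E' \<noteq> {}"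
  using assms by (force simp: accepts_def)

text \<open>For a copy in \<open>b\<close>, \<open>K < N\<close> leaves an index \<open>a\<close>
  whose coordinate avoids \<open>T\<close>, and the graph of \<open>F a\<close> lies in the fixed
  part. For other copies the hypothesis \<open>transversal\<close> supplies \<open>H\<close> off
  \<open>T\<close>, with the exceptional indices \<open>W\<close> in the fixed part.\<close>

lemma accepts_exists:
  assumes "i < m" "T \<subseteq> coords" "card T \<le> K"
  shows "\<exists>E D. {i} \<times> E \<subseteq> fixed b \<and> {i} \<times> D \<subseteq> coords - fixed b - T \<and> D \<noteq> {} \<and>
    card E \<le> t \<and> card D \<le> t \<and> accepts b i E D"
proof -
  have finT: "finite T" using assms(2) finite_coords by (rule finite_subset)
  show ?thesis
  proof (cases "i \<in> b")
    case True
    have "card {a. (i, Inl a) \<in> T} \<le> card T"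
      using finT by (intro card_inj_on_le[of "\<lambda>a. (i, Inl a)"]) (auto simp: inj_on_def)
    moreover have "finite {a. (i, Inl a) \<in> T}"
      using finite_vimageI[OF finT, of "\<lambda>a. (i, Inl a)"] by (simp add: vimage_def inj_on_def)
    ultimately have "\<not> {..<N} \<subseteq> {a. (i, Inl a) \<in> T}"
      using card_mono[of "{a. (i, Inl a) \<in> T}" "{..<N}"] assms(3) bounds(1) by auto
    then obtain a where a: "a < N" "(i, Inl a) \<notin> T" by blast
    let ?E = "(\<lambda>x. Inr (x, F a x)) ` {..<q} :: (nat + nat \<times> nat) set"
    have "{i} \<times> ?E \<subseteq> fixed b" using assms(1) True F[OF a(1)] by (auto simp: fixed_def coords_def)
    moreover have "{i} \<times> {Inl a} \<subseteq> coords - fixed b - T"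
      using assms(1) True a by (auto simp: fixed_def coords_def)
    moreover have "card ?E \<le> t" using card_image_le[of "{..<q}"] bounds(2) by (metis card_lessThan finite_lessThan order_trans)
    moreover have "accepts b i ?E {Inl a}" using True a by (auto simp: accepts_def)
    moreover have "card {Inl a :: nat + nat \<times> nat} \<le> t" using bounds(3) by simp
    ultimately show ?thesis by blast
  next
    case False
    define T' where "T' = {p. (i, Inr p) \<in> T}"
    have "card T' \<le> card T"
      unfolding T'_def using finT by (intro card_inj_on_le[of "\<lambda>a. (i, Inr a)"]) (auto simp: inj_on_def)
    moreover have "T' \<subseteq> {..<q} \<times> {..<q}" using assms(2) by (auto simp: T'_def coords_def)
    ultimately obtain H W where H: "H \<subseteq> {..<q} \<times> {..<q} - T'" "H \<noteq> {}" "card H \<le> t"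
      "W \<subseteq> {..<N}" "card W \<le> t" "\<forall>a<N. a \<in> W \<or> (\<exists>x<q. (x, F a x) \<in> H)"
      using transversal[of T'] assms(3) by auto
    let ?E = "Inl ` W :: (nat + nat \<times> nat) set" and ?D = "Inr ` H :: (nat + nat \<times> nat) set"
    have "{i} \<times> ?E \<subseteq> fixed b" using assms(1) False H(4) by (auto simp: fixed_def coords_def)
    moreover have "{i} \<times> ?D \<subseteq> coords - fixed b - T"
      using assms(1) False H(1) by (auto simp: fixed_def coords_def T'_def)
    moreover have "card ?E \<le> t" "card ?D \<le> t" using H(3,5) by (simp_all add: card_image)
    moreover have "accepts b i ?E ?D" using False H(6) by (auto simp: accepts_def)
    ultimately show ?thesis using H(2) by (metis image_is_empty)
  qed
qed

text \<open>Distinct cells differ in some copy, where the certificates conflict. Robustness is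
  obtained copy by copy, so the widths add up to at most \<open>m * t\<close>.\<close>

lemma term_system: "term_system coords (Pow {..<m}) copy_terms fixed (m * t) K"
proof
  fix b b' E D E' D'
  assume b: "b \<in> Pow {..<m}" "b' \<in> Pow {..<m}" "b \<noteq> b'" and t: "(E, D) \<in> copy_terms b" "(E', D') \<in> copy_terms b'"
  then obtain i where "i < m" and i: "i \<in> b \<and> i \<notin> b' \<or> i \<in> b' \<and> i \<notin> b" by blast
  then have "accepts b i (E `` {i}) (D `` {i})" "accepts b' i (E' `` {i}) (D' `` {i})"
    using t by (auto simp: copy_terms_def)
  then show "E \<inter> D' \<noteq> {} \<or> D \<inter> E' \<noteq> {}"
    using i accepts_conflict[of b i _ _ b'] accepts_conflict[of b' i _ _ b] by blast
next
  fix b T assume "b \<in> Pow {..<m}" and T: "T \<subseteq> coords - fixed b" "card T \<le> K"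
  then have "T \<subseteq> coords" by blast
  then have "\<forall>i\<in>{..<m}. \<exists>p. {i} \<times> fst p \<subseteq> fixed b \<and> {i} \<times> snd p \<subseteq> coords - fixed b - T \<and> snd p \<noteq> {} \<and>
      card (fst p) \<le> t \<and> card (snd p) \<le> t \<and> accepts b i (fst p) (snd p)"
    using accepts_exists[of _ T b] T(2) by simp
  then obtain p where p: "\<And>i. i < m \<Longrightarrow> {i} \<times> fst (p i) \<subseteq> fixed b \<and> {i} \<times> snd (p i) \<subseteq> coords - fixed b - T \<and>
      snd (p i) \<noteq> {} \<and> card (fst (p i)) \<le> t \<and> card (snd (p i)) \<le> t \<and> accepts b i (fst (p i)) (snd (p i))"
    unfolding bchoice_iff by (elim exE) (rule that, erule bspec, simp)
  define E where "E = Sigma {..<m} (\<lambda>i. fst (p i))"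
  define D where "D = Sigma {..<m} (\<lambda>i. snd (p i))"
  have ED: "E \<subseteq> fixed b" "D \<subseteq> coords - fixed b - T"
    using p by (fastforce simp: E_def D_def)+
  have fx: "fixed b \<subseteq> coords" by (auto simp: fixed_def)
  have fin: "finite E" "finite D"
    using ED fx finite_coords by (auto intro: finite_subset)
  have sz: "card (Sigma {..<m} f) \<le> m * t" if "finite (Sigma {..<m} f)" "\<And>i. i < m \<Longrightarrow> card (f i) \<le> t"
    for f :: "nat \<Rightarrow> (nat + nat \<times> nat) set"
  proof -
    have "Sigma {..<m} f = (\<Union>i<m. {i} \<times> f i)" by auto
    then have "card (Sigma {..<m} f) \<le> (\<Sum>i<m. card ({i} \<times> f i))"
      using card_UN_le[of "{..<m}" "\<lambda>i. {i} \<times> f i"] by simp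
    also have "\<dots> \<le> (\<Sum>i<m. t)" using that(2) by (intro sum_mono) (simp add: card_cartesian_product)
    finally show ?thesis by simp
  qed
  have "card E \<le> m * t" "card D \<le> m * t"
    using fin p unfolding E_def D_def by (auto intro!: sz)
  moreover have "E `` {i} = fst (p i)" "D `` {i} = snd (p i)" if "i < m" for i
    using that by (auto simp: E_def D_def)
  moreover have "D \<noteq> {}"
  proof -
    have "0 < m" using bounds(4) by simp
    moreover from this obtain z where "z \<in> snd (p 0)" using p by blast
    ultimately have "(0, z) \<in> D" by (simp add: D_def)
    then show ?thesis by blast
  qed
  moreover have "E \<subseteq> coords" "D \<subseteq> coords" using ED fx by blast+
  ultimately have "(E, D) \<in> copy_terms b"
    using p by (simp add: copy_terms_def)
  moreover have "E \<subseteq> fixed b \<and> D \<inter> (fixed b \<union> T) = {}" using ED by blast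
  ultimately show "\<exists>(E, D)\<in>copy_terms b. E \<subseteq> fixed b \<and> D \<inter> (fixed b \<union> T) = {}"
    by (intro bexI[of _ "(E, D)"]) simp_all
qed (auto simp: finite_coords copy_terms_def fixed_def)

end

section \<open>Parameters\<close>

text \<open>Turns \<open>q^2 <= 2 ^ (14 * l)\<close> into the factorial bound needed to find
  \<open>q^2\<close> almost disjoint functions.\<close>

lemma two_power_le_fact_Suc: "2 ^ n \<le> (fact (Suc n) :: nat)"
proof (induction n)
  case (Suc n)
  have "2 * 2 ^ n \<le> Suc (Suc n) * (fact (Suc n) :: nat)"
    using Suc by (intro mult_mono) simp_all
  then show ?case by (simp only: fact_Suc[of "Suc n"] power_Suc of_nat_id)
qed simp

lemma mult_le_two_power:
  fixes a b :: nat
  assumes "a \<le> 2 ^ x" "b \<le> 2 ^ y" "x + y \<le> z"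
  shows "a * b \<le> 2 ^ z"
proof -
  have "a * b \<le> 2 ^ x * 2 ^ y" using assms(1,2) by (rule mult_le_mono)
  also have "\<dots> = 2 ^ (x + y)" by (simp only: power_add)
  also have "\<dots> \<le> 2 ^ z" using assms(3) by (intro power_increasing) simp_all
  finally show ?thesis .
qed

lemma power_le_two_power:
  fixes a :: nat
  assumes "a \<le> 2 ^ x" "x * r \<le> z"
  shows "a ^ r \<le> 2 ^ z"
proof -
  have "a ^ r \<le> (2 ^ x) ^ r" using assms(1) by (rule power_mono) simp
  also have "\<dots> = 2 ^ (x * r)" by (simp only: power_mult)
  also have "\<dots> \<le> 2 ^ z" using assms(2) by (intro power_increasing) simp_all
  finally show ?thesis .
qed

text \<open>The parameter \<open>l\<close> is the binary logarithm of \<open>k\<close>, rounded up.\<close>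

context
  fixes k l q m w :: nat
  assumes k: "2 \<le> k" and l: "1 \<le> l" "k \<le> 2 ^ l" "2 ^ l \<le> 2 * k"
    and q: "q = 32 * k * l" and m: "m = Suc (2 * l)" and w: "w = m * (30 * q * l)"
begin

lemma l_le: "l \<le> 2 ^ l" and m_le: "m \<le> 3 * l" and w_le: "w \<le> 2880 * (k * l ^ 3)"
  and square_k: "4 \<le> k\<^sup>2"
proof -
  show "l \<le> 2 ^ l" using less_exp[of l] by simp
  show m3: "m \<le> 3 * l" using l(1) by (simp add: m)
  have "w \<le> 3 * l * (30 * q * l)" unfolding w using m3 by (rule mult_right_mono) simp
  also have "\<dots> = 2880 * (k * l ^ 3)" by (simp add: q power3_eq_cube)
  finally show "w \<le> 2880 * (k * l ^ 3)" .
  show "4 \<le> k\<^sup>2" using power_mono[OF k, of 2] by simp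
qed

lemma square_q_le: "q\<^sup>2 \<le> 2 ^ (14 * l)"
  unfolding q using l l_le
  by (intro power_le_two_power[of _ "7 * l"] mult_le_two_power[of _ "6 * l" _ l]
      mult_le_two_power[of _ 5 _ l]) simp_all

text \<open>The left side is the robustness required for independence density
  \<open>2 ^ - k^2\<close> with \<open>2 ^ m\<close> cells. It must stay below both the size of
  \<open>T\<close> that the transversals tolerate and the number \<open>q^2\<close> of
  functions.\<close>

lemma deficiency_less: "k\<^sup>2 + 1 + m < 9 * k\<^sup>2 * l" "9 * k\<^sup>2 * l \<le> q\<^sup>2"
proof -
  have "4 * l \<le> k\<^sup>2 * l" using square_k by (rule mult_right_mono) simp
  moreover have "k\<^sup>2 * 1 \<le> k\<^sup>2 * l" using l(1) by (rule mult_left_mono) simp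
  ultimately have "k\<^sup>2 + 1 + m < 9 * (k\<^sup>2 * l)" using l(1) m by linarith
  then show "k\<^sup>2 + 1 + m < 9 * k\<^sup>2 * l" by (simp only: mult.assoc)
  have "9 * k\<^sup>2 * l \<le> 1024 * k\<^sup>2 * (l * l)" using l by (intro mult_mono) simp_all
  then show "9 * k\<^sup>2 * l \<le> q\<^sup>2" by (simp add: q power_mult_distrib power2_eq_square mult_ac)
qed

lemma k_l_powers_le: "k * l ^ 3 \<le> 2 ^ (4 * l)" "k\<^sup>2 * l ^ 3 \<le> 2 ^ (5 * l)"
  and k_l_powers_ge: "1 \<le> k * l ^ 3" "1 \<le> k\<^sup>2 * l ^ 3"
proof -
  have l3: "l ^ 3 \<le> 2 ^ (3 * l)" using l_le by (rule power_le_two_power) simp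
  show "k * l ^ 3 \<le> 2 ^ (4 * l)" using l(2) l3 by (rule mult_le_two_power) simp
  have "k\<^sup>2 \<le> 2 ^ (2 * l)" using l(2) by (rule power_le_two_power) simp
  then show "k\<^sup>2 * l ^ 3 \<le> 2 ^ (5 * l)" using l3 by (rule mult_le_two_power) simp
  show "1 \<le> k * l ^ 3" "1 \<le> k\<^sup>2 * l ^ 3" using k l(1) by simp_all
qed

lemma alphabet_le: "Suc (2 * w) \<le> 2 ^ (17 * l)"
proof -
  \<comment> \<open>Here \<open>2 * 2880 + 1\<close> is below \<open>8192 = 2 ^ 13\<close>, and
    \<open>13 + 4 * l <= 17 * l\<close> since \<open>l >= 1\<close>.\<close>
  have "Suc (2 * w) \<le> 8192 * (k * l ^ 3)" using w_le k_l_powers_ge(1) by linarith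
  also have "\<dots> \<le> 2 ^ (17 * l)"
    by (rule mult_le_two_power[of 8192 13, OF _ k_l_powers_le(1)]) (use l(1) in simp_all)
  finally show ?thesis .
qed

lemma coords_le: "m * (q\<^sup>2 + q * q) \<le> 6144 * (k\<^sup>2 * l ^ 3)"
proof -
  have "m * (q\<^sup>2 + q * q) \<le> 3 * l * (q\<^sup>2 + q * q)" using m_le by (rule mult_right_mono) simp
  also have "\<dots> = 6144 * (k\<^sup>2 * l ^ 3)"
    by (simp add: q power2_eq_square power3_eq_cube)
  finally show ?thesis .
qed

lemma cell_alphabet_le:
  assumes "c \<le> 6144 * (k\<^sup>2 * l ^ 3)"
  shows "(Suc c ^ w)\<^sup>2 \<le> 2 ^ (36 * (l * w))"
proof -
  have "Suc c \<le> 8192 * (k\<^sup>2 * l ^ 3)" using assms k_l_powers_ge(2) by linarith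
  also have "\<dots> \<le> 2 ^ (18 * l)"
    by (rule mult_le_two_power[of 8192 13, OF _ k_l_powers_le(2)]) (use l(1) in simp_all)
  finally have "Suc c ^ w \<le> 2 ^ (18 * l * w)" by (rule power_le_two_power) simp
  then show ?thesis by (rule power_le_two_power) simp
qed

lemma l_w_le: "l * w \<le> 2880 * (k * l ^ 4)"
proof -
  have "l * w \<le> l * (2880 * (k * l ^ 3))" using w_le by (rule mult_left_mono) simp
  also have "\<dots> = 2880 * (k * (l * l ^ 3))" by (simp only: mult_ac)
  also have "l * l ^ 3 = l ^ 4" by (simp add: power_numeral_reduce)
  finally show ?thesis .
qed

text \<open>The choice \<open>m = 2 * l + 1\<close> makes the number of cells twice the square of
  \<open>2 ^ l\<close>, hence between \<open>2 * k^2\<close> and \<open>8 * k^2\<close>.\<close>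

lemma cells_le: "2 ^ m \<le> 8 * k\<^sup>2" and cells_ge: "k\<^sup>2 + 2 \<le> 2 ^ m"
proof -
  have m2: "2 ^ m = 2 * ((2 :: nat) ^ l)\<^sup>2" by (simp add: m power_even_eq)
  show "2 ^ m \<le> 8 * k\<^sup>2" using power_mono[OF l(3), of 2] by (simp add: m2 power_mult_distrib)
  have "k\<^sup>2 \<le> (2 ^ l)\<^sup>2" using l(2) by (rule power_mono) simp
  then show "k\<^sup>2 + 2 \<le> 2 ^ m" using square_k unfolding m2 by linarith
qed

text \<open>The cells dominate: about \<open>k^2\<close> of them, each with a content of about
  \<open>k * l^4\<close> bits. One factor \<open>l\<close> is traded for \<open>2 * k\<close>, which
  gives the shape \<open>k^4 * l^3\<close>.\<close>

lemma vertices_le: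
  fixes Q M :: nat
  assumes "c \<le> 6144 * (k\<^sup>2 * l ^ 3)" "Q \<le> 2 ^ (17 * l)" "M \<le> 2 ^ (36 * (l * w))"
  shows "Q ^ c * M ^ 2 ^ m \<le> 2 ^ (2000000 * k ^ 4 * l ^ 3)"
proof (rule mult_le_two_power)
  have "l \<le> 2 * k" using l_le l(3) by (rule order_trans)
  then have "l * l ^ 3 \<le> 2 * k * l ^ 3" by (rule mult_right_mono) simp
  then have l4: "l * l ^ 3 \<le> 2 * (k * l ^ 3)" by (simp only: mult.assoc)
  have "17 * l * c \<le> 17 * l * (6144 * (k\<^sup>2 * l ^ 3))" using assms(1) by (rule mult_left_mono) simp
  also have "\<dots> = 104448 * k\<^sup>2 * (l * l ^ 3)" by simp
  also have "\<dots> \<le> 104448 * k\<^sup>2 * (2 * (k * l ^ 3))" using l4 by (rule mult_left_mono) simp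
  also have "\<dots> = 208896 * (k ^ 3 * l ^ 3)" by (simp add: power2_eq_square power3_eq_cube)
  also have "\<dots> \<le> 208896 * (k ^ 4 * l ^ 3)"
    using k by (intro mult_left_mono mult_right_mono power_increasing) simp_all
  finally show "Q ^ c \<le> 2 ^ (208896 * (k ^ 4 * l ^ 3))" using assms(2) power_le_two_power by blast
  have "36 * (l * w) * 2 ^ m \<le> 36 * (2880 * (k * l ^ 4)) * (8 * k\<^sup>2)"
    by (rule mult_le_mono[OF mult_le_mono2[OF l_w_le] cells_le])
  also have "\<dots> = 829440 * (k * k\<^sup>2) * (l * l ^ 3)" by (simp add: power_numeral_reduce)
  also have "\<dots> \<le> 829440 * (k * k\<^sup>2) * (2 * (k * l ^ 3))" using l4 by (rule mult_left_mono) simp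
  also have "\<dots> = 1658880 * (k ^ 4 * l ^ 3)" by (simp add: power_numeral_reduce)
  finally show "M ^ 2 ^ m \<le> 2 ^ (1658880 * (k ^ 4 * l ^ 3))" using assms(3) power_le_two_power by blast
qed simp

text \<open>A biclique reads only one cell, so the number of cells is a mere factor here, while it
  is an exponent in the vertex count.\<close>

lemma bicliques_le:
  fixes Q M :: nat
  assumes "Q \<le> 2 ^ (17 * l)" "M \<le> 2 ^ (36 * (l * w))"
  shows "2 ^ m * M ^ 3 * Q ^ (4 * w) \<le> 2 ^ (1000000 * k * l ^ 4)"
proof -
  have "M ^ 3 \<le> 2 ^ (108 * (l * w))" using assms(2) by (rule power_le_two_power) simp
  with order_refl have "2 ^ m * M ^ 3 \<le> 2 ^ (m + 108 * (l * w))" by (rule mult_le_two_power) simp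
  moreover have "Q ^ (4 * w) \<le> 2 ^ (68 * (l * w))" using assms(1) by (rule power_le_two_power) simp
  moreover have "m + 108 * (l * w) + 68 * (l * w) \<le> 1000000 * k * l ^ 4"
  proof -
    have "l * 1 \<le> l * (k * l ^ 3)" using k_l_powers_ge(1) by (rule mult_left_mono) simp
    also have "\<dots> = k * l ^ 4" by (simp add: power_numeral_reduce)
    finally show ?thesis using l_w_le m_le by linarith
  qed
  ultimately show ?thesis by (rule mult_le_two_power)
qed

end

lemma graph_with_parameters:
  fixes k l :: nat
  assumes k: "2 \<le> k" and l: "1 \<le> l" "k \<le> 2 ^ l" "2 ^ l \<le> 2 * k"
  defines "n \<equiv> 2 ^ (2000000 * k ^ 4 * l ^ 3)"
  shows "\<exists>E. simple_graph n E \<and> bp n E \<le> 2 ^ (1000000 * k * l ^ 4) \<and> 2 ^ k\<^sup>2 \<le> chromatic_number n E"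
proof -
  define q where "q = 32 * k * l"
  define m where "m = Suc (2 * l)"
  define t where "t = 30 * q * l"
  define K where "K = k\<^sup>2 + 1 + m"
  define w where "w = m * t"
  note par = k l q_def m_def w_def[unfolded t_def]
  have "0 < q" using k l by (simp add: q_def)
  note q14 = square_q_le[OF par]
  have K9: "K < 9 * k\<^sup>2 * l" and KN: "K < q\<^sup>2"
    using deficiency_less[OF par] by (simp_all add: K_def)
  \<comment> \<open>The greedy construction is used with agreement bound \<open>14 * l\<close>,
    matching \<open>q^2 <= 2 ^ (14 * l)\<close>.\<close>
  obtain F :: "nat \<Rightarrow> nat \<Rightarrow> nat" where F: "\<forall>a<q\<^sup>2. \<forall>x<q. F a x < q"
    "\<forall>a<q\<^sup>2. \<forall>a'<q\<^sup>2. a \<noteq> a' \<longrightarrow> card {x. x < q \<and> F a x = F a' x} \<le> 14 * l"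
    using exists_almost_disjoint_functions[OF \<open>0 < q\<close> order_trans[OF q14 two_power_le_fact_Suc]]
    by (elim exE conjE) (rule that)
  interpret transversal_game q "q\<^sup>2" t K m F
  proof
    fix T assume T: "T \<subseteq> {..<q} \<times> {..<q}" "card T \<le> K"
    have pos: "0 < k" "0 < l" using k l by simp_all
    show "\<exists>H W. H \<subseteq> {..<q} \<times> {..<q} - T \<and> H \<noteq> {} \<and> card H \<le> t \<and> W \<subseteq> {..<q\<^sup>2} \<and> card W \<le> t \<and>
        (\<forall>a<q\<^sup>2. a \<in> W \<or> (\<exists>x<q. (x, F a x) \<in> H))"
      unfolding t_def
      by (rule exists_transversal_outside[OF _ _ q_def q14 pos T(1)]) (use F T(2) K9 in simp_all)
  next
    show "q \<le> t" "1 \<le> t" using \<open>0 < q\<close> l(1) by (simp_all add: t_def)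
  next
    show "F a x < q" if "a < q\<^sup>2" "x < q" for a x using F(1) that by blast
  next
    show "K < q\<^sup>2" "1 \<le> m" using KN by (simp_all add: m_def)
  qed
  interpret ts: term_system coords "Pow {..<m}" copy_terms fixed w K
    unfolding w_def by (rule term_system)
  have cc: "card coords \<le> 6144 * (k\<^sup>2 * l ^ 3)"
    unfolding card_coords by (rule coords_le[OF par])
  have Q: "ts.Q \<le> 2 ^ (17 * l)" unfolding ts.Q_def by (rule alphabet_le[OF par])
  have M: "ts.M \<le> 2 ^ (36 * (l * w))" unfolding ts.M_def by (rule cell_alphabet_le[OF par cc])
  have cells: "card (Pow {..<m}) = 2 ^ m" by (simp add: card_Pow)
  have "\<exists>E. simple_graph n E \<and> bp n E \<le> card (Pow {..<m}) * ts.M ^ 3 * ts.Q ^ (4 * w) \<and>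
      2 ^ k\<^sup>2 \<le> chromatic_number n E"
  proof (rule ts.term_system_graph)
    show "k\<^sup>2 + 2 \<le> card (Pow {..<m})" "card (Pow {..<m}) \<le> 2 ^ m"
      using cells_ge[OF par] unfolding cells by simp_all
    show "k\<^sup>2 + 1 + m \<le> K" by (simp add: K_def)
    show "ts.Q ^ card coords * ts.M ^ card (Pow {..<m}) \<le> n"
      unfolding n_def cells by (rule vertices_le[OF par cc Q M])
  qed
  then show ?thesis
    using bicliques_le[OF par Q M] unfolding cells by (meson order_trans)
qed

theorem theorem1p8:
  shows "\<exists>C1 C2 C3 c :: real. C1 > 0 \<and> C2 > 0 \<and> C3 > 0 \<and> c > 0 \<and>
    (\<forall>k::nat. k \<ge> 2 \<longrightarrow>
      (\<exists>n E. simple_graph n E \<and>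
         2 powr (c * real k ^ 4 * (log 2 (real k)) ^ 3) \<le> real n \<and>
         real n \<le> 2 powr (C1 * real k ^ 4 * (log 2 (real k)) ^ 3) \<and>
         real (bp n E) \<le> 2 powr (C2 * real k * (log 2 (real k)) ^ 4) \<and>
         real (chromatic_number n E) \<ge> 2 powr (C3 * real k ^ 2)))"
proof (rule exI[of _ 16000000], rule exI[of _ 16000000], rule exI[of _ 1], rule exI[of _ 1], intro conjI allI impI)
  fix k :: nat assume k: "2 \<le> k"
  define L where "L = log 2 (real k)"
  define l where "l = nat \<lceil>L\<rceil>"
  have L1: "1 \<le> L" using k by (simp add: L_def le_log_iff)
  have kL: "real k = 2 powr L" using k by (simp add: L_def)
  \<comment> \<open>Rounding the logarithm up at most doubles it as \<open>L >= 1\<close>; its third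
    and fourth powers then cost the factors 8 and 16 that lead to the constant 16000000 in both
    upper bounds.\<close>
  have lL: "L \<le> real l" "real l \<le> 2 * L" and lL': "real l \<le> L + 1"
    using L1 unfolding l_def by linarith+
  have l: "1 \<le> l" using lL(1) L1 by linarith
  have "real k \<le> 2 powr real l" using kL lL(1) by simp
  then have "real k \<le> real (2 ^ l)" by (simp add: powr_realpow)
  then have kl: "k \<le> 2 ^ l" by (simp only: of_nat_le_iff)
  have "2 powr real l \<le> 2 powr (L + 1)" using lL' by simp
  also have "\<dots> = 2 * real k" using kL by (simp add: powr_add)
  finally have "real (2 ^ l) \<le> real (2 * k)" by (simp add: powr_realpow)
  then have lk: "2 ^ l \<le> 2 * k" by (simp only: of_nat_le_iff)
  \<comment> \<open>The vertex count is prescribed exactly, so the lower bound on it follows from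
    \<open>L <= l\<close>.\<close>
  define n where "n = (2::nat) ^ (2000000 * k ^ 4 * l ^ 3)"
  obtain E where E: "simple_graph n E" "bp n E \<le> 2 ^ (1000000 * k * l ^ 4)" "2 ^ k\<^sup>2 \<le> chromatic_number n E"
    using graph_with_parameters[OF k l kl lk] unfolding n_def by blast
  have n: "real n = 2 powr (2000000 * real k ^ 4 * real l ^ 3)"
    by (simp add: n_def flip: powr_realpow)
  have p3: "L ^ 3 \<le> real l ^ 3" "real l ^ 3 \<le> 8 * L ^ 3"
    using power_mono[OF lL(1), of 3] power_mono[OF lL(2), of 3] L1 by (simp_all add: power_mult_distrib)
  have p4: "real l ^ 4 \<le> 16 * L ^ 4"
    using power_mono[OF lL(2), of 4] by (simp add: power_mult_distrib)
  have "1 * real k ^ 4 * L ^ 3 \<le> 2000000 * real k ^ 4 * real l ^ 3"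
    using p3 L1 by (intro mult_mono) simp_all
  then have lower: "2 powr (1 * real k ^ 4 * (log 2 (real k)) ^ 3) \<le> real n"
    unfolding n L_def[symmetric] by simp
  have "2000000 * real k ^ 4 * real l ^ 3 \<le> 2000000 * real k ^ 4 * (8 * L ^ 3)"
    using p3 by (intro mult_left_mono) simp_all
  then have upper: "real n \<le> 2 powr (16000000 * real k ^ 4 * (log 2 (real k)) ^ 3)"
    unfolding n L_def[symmetric] by (simp add: mult_ac)
  have "real (bp n E) \<le> real (2 ^ (1000000 * k * l ^ 4))" using E(2) by (simp only: of_nat_le_iff)
  also have "\<dots> = 2 powr (1000000 * real k * real l ^ 4)" by (simp flip: powr_realpow)
  also have "\<dots> \<le> 2 powr (16000000 * real k * L ^ 4)"
    using mult_left_mono[OF p4, of "1000000 * real k"] by (simp add: mult_ac)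
  finally have bp: "real (bp n E) \<le> 2 powr (16000000 * real k * (log 2 (real k)) ^ 4)"
    unfolding L_def .
  have "2 powr (1 * real k ^ 2) = real (2 ^ k\<^sup>2)" by (simp flip: powr_realpow)
  also have "\<dots> \<le> real (chromatic_number n E)" using E(3) by (simp only: of_nat_le_iff)
  finally have "2 powr (1 * real k ^ 2) \<le> real (chromatic_number n E)" .
  with E(1) lower upper bp show "\<exists>n E. simple_graph n E \<and>
      2 powr (1 * real k ^ 4 * (log 2 (real k)) ^ 3) \<le> real n \<and>
      real n \<le> 2 powr (16000000 * real k ^ 4 * (log 2 (real k)) ^ 3) \<and>
      real (bp n E) \<le> 2 powr (16000000 * real k * (log 2 (real k)) ^ 4) \<and>
      real (chromatic_number n E) \<ge> 2 powr (1 * real k ^ 2)" by blast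
qed simp_all

end
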